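(* In the almost observable model of the stochastic clearing system in alternating environment, suppose that $(\mu_1-\mu_2)(\rho_1-\rho_2)<0$. Then equilibrium threshold strategies always exist. In particular: Case I: if $H^U(0)<0$, there is a unique equilibrium threshold strategy, the $\lceil 0\rceil$ strategy (always balk). Case II: if $H^U(0)\ge 0$ and $\lim_{n\to\infty}H^U(n)<0$, an equilibrium pure threshold strategy always exists. Moreover, the equilibrium strategies within the class of all pure threshold strategies are exactly the strategies $\lceil n_0\rceil$ with $n_0=n_L,n_L+1,\dots,n_U$. Also, the equilibrium strategies within the class of genuinely mixed threshold strategies (those $\lceil n_0,\theta\rceil$ with $\theta\in(0,1)$) are exactly the strategies $\lceil n_0,\theta(n_0)\rceil$ with $n_0\in\{n_L^+,\dots,n_U^--1\}$, where $\theta(n_0)$ is the unique solution in $(0,1)$ of $F(n_0,\theta)=0$ with respect to $\theta$. Case III: if $\lim_{n\to\infty}H^U(n)\ge 0$, there is a unique equilibrium threshold strategy, the $\lceil\infty\rceil$ strategy (always join).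
   Context: Model. $\lambda_1,\lambda_2,\mu_1,\mu_2,q_{12},q_{21},R,C$ are positive reals; $\rho_e=\lambda_e/\mu_e$. The environment is a continuous-time Markov chain on $\{1,2\}$ with rates $q_{12}$ (from 1 to 2) and $q_{21}$ (from 2 to 1). While the environment is $e$, customers arrive as a Poisson process of rate $\lambda_e$ and, independently, a facility visits at rate $\mu_e$ and removes all present customers. A customer who joins gets reward $R$ minus $C$ per unit of time until the next visit; balking gives $0$. Almost observable case. An arriving customer observes the number $n$ of customers present but not the environment. A strategy is a vector $s=(\theta_0,\theta_1,\dots)\in[0,1]^{\mathbb N}$, $\theta_n$ being the probability of joining when $n$ customers are seen. Threshold strategies: $\lceil n_0,\theta\rceil$ ($n_0\in\{0,1,\dots\}$, $\theta\in[0,1]$) has $\theta_i=1$ for $i<n_0$, $\theta_{n_0}=\theta$, $\theta_i=0$ for $i>n_0$; $\lceil n_0\rceil=\lceil n_0,0\rceil$ is the $n_0$-pure threshold strategy; $\lceil\infty\rceil$ has $\theta_i=1$ for all $i$ and is also a (pure) threshold strategy. Payoffs. When all customers use $s$, the state (number of customers, environment) is a Markov chain on $\{0,1,\dots\}\times\{1,2\}$ with rates $\lambda_e\theta_n$ for $(n,e)\to(n+1,e)$, $\mu_e$ for $(n,e)\to(0,e)$ ($n\ge1$), $q_{12}$ for $(n,1)\to(n,2)$, $q_{21}$ for $(n,2)\to(n,1)$; let $p_{ao}(n,e;s)$ be its stationary distribution. An arriving customer finds $n$ customers with probability $\pi(n;s)=\frac{\lambda_1p_{ao}(n,1;s)+\lambda_2p_{ao}(n,2;s)}{\sum_m(\lambda_1p_{ao}(m,1;s)+\lambda_2p_{ao}(m,2;s))}$.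 Let $$T_1=\frac{\mu_2+q_{21}+q_{12}}{K},\quad T_2=\frac{\mu_1+q_{21}+q_{12}}{K},\quad K=\mu_1\mu_2+\mu_1q_{21}+\mu_2q_{12}$$ be the mean times to the next visit from environment 1, 2. For $\pi(n;s)>0$, the expected net benefit of joining when seeing $n$ is $$S_{ao}(n;s)=R-C\,\frac{\lambda_1p_{ao}(n,1;s)T_1+\lambda_2p_{ao}(n,2;s)T_2}{\lambda_1p_{ao}(n,1;s)+\lambda_2p_{ao}(n,2;s)}.$$ The payoff of a tagged customer using $(\theta_n')$ against $s$ is $\mathcal U((\theta'_n),s)=\sum_{n:\pi(n;s)>0}\pi(n;s)\,\theta_n'\,S_{ao}(n;s)$. A strategy $s$ is an equilibrium if $\mathcal U(s,s)\ge\mathcal U(s',s)$ for every strategy $s'$. Functions. $p_E(1)=\frac{q_{21}}{q_{12}+q_{21}}$, $p_E(2)=\frac{q_{12}}{q_{12}+q_{21}}$, $\Delta=[\lambda_2(\mu_1+q_{12})-\lambda_1(\mu_2+q_{21})]^2+4\lambda_1\lambda_2q_{12}q_{21}$, $z_{1,2}=\frac{-\lambda_1(\mu_2+q_{21})-\lambda_2(\mu_1+q_{12})\pm\sqrt\Delta}{2\lambda_1\lambda_2}$ ($z_1$ with $+$, $z_2$ with $-$); $A_1=\frac{(\mu_1\lambda_2z_1+K)p_E(1)}{\sqrt\Delta(1-z_1)}$, $B_1=-\frac{(\mu_1\lambda_2z_2+K)p_E(1)}{\sqrt\Delta(1-z_2)}$, $A_2=\frac{(\mu_2\lambda_1z_1+K)p_E(2)}{\sqrt\Delta(1-z_1)}$,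 $B_2=-\frac{(\mu_2\lambda_1z_2+K)p_E(2)}{\sqrt\Delta(1-z_2)}$; $A=\lambda_1A_1T_1+\lambda_2A_2T_2$, $B=\lambda_1B_1T_1+\lambda_2B_2T_2$, $D=\lambda_1A_1+\lambda_2A_2$, $E=\lambda_1B_1+\lambda_2B_2$. For $n\ge0$, $\theta\in[0,1]$ (with $0^0=1$), $$F(n,\theta)=\sum_{i=n}^\infty(1-\theta)^{i-n}\Bigl[(RD-CA)\bigl(\tfrac1{1-z_1}\bigr)^i+(RE-CB)\bigl(\tfrac1{1-z_2}\bigr)^i\Bigr],$$ $$G(n,\theta)=\sum_{i=n}^\infty(1-\theta)^{i-n}\Bigl[D\bigl(\tfrac1{1-z_1}\bigr)^i+E\bigl(\tfrac1{1-z_2}\bigr)^i\Bigr],\qquad H^U(n)=\frac{F(n,1)}{G(n,1)}.$$ With $\inf\emptyset=\infty$: $n_U=\inf\{n\ge0:F(n,1)<0\}$, $n_L=\inf\{n\ge0:F(n,0)\le0\}$, $n_U^-=\inf\{n\ge0:F(n,1)\le0\}$, $n_L^+=\inf\{n\ge0:F(n,0)<0\}$. The set $\{n_L^+,\dots,n_U^--1\}$ is empty if $n_U^--1<n_L^+$. *)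

theory Defs
  imports "HOL-Probability.Probability" "HOL-Library.Extended_Nat"
begin

datatype env = E1 | E2

fun other :: "env \<Rightarrow> env" where
  "other E1 = E2"
| "other E2 = E1"

text \<open>
  Parameters of the clearing system: \<open>arr e\<close> is \<open>\<lambda>\<^sub>e\<close>, \<open>vis e\<close> is \<open>\<mu>\<^sub>e\<close>, and \<open>sw e\<close> is the rate
  at which the environment leaves \<open>e\<close>, that is \<open>sw E1\<close> is \<open>q\<^sub>1\<^sub>2\<close> and \<open>sw E2\<close> is \<open>q\<^sub>2\<^sub>1\<close>.
\<close>

record clearing_model =
  arr :: "env \<Rightarrow> real"
  vis :: "env \<Rightarrow> real"
  sw :: "env \<Rightarrow> real"
  reward :: real
  cost :: real

definition valid_model :: "clearing_model \<Rightarrow> bool" where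
  "valid_model M \<longleftrightarrow>
     (\<forall>e. arr M e > 0 \<and> vis M e > 0 \<and> sw M e > 0) \<and> reward M > 0 \<and> cost M > 0"

definition rho :: "clearing_model \<Rightarrow> env \<Rightarrow> real" where
  "rho M e = arr M e / vis M e"

section \<open>Strategies\<close>

type_synonym strategy = "nat \<Rightarrow> real"

definition strategies :: "strategy set" where
  "strategies = {s. \<forall>n. 0 \<le> s n \<and> s n \<le> 1}"

definition threshold :: "nat \<Rightarrow> real \<Rightarrow> strategy" where
  "threshold n\<^sub>0 \<theta> = (\<lambda>i. if i < n\<^sub>0 then 1 else if i = n\<^sub>0 then \<theta> else 0)"

definition pure_threshold :: "enat \<Rightarrow> strategy" where
  "pure_threshold m = (case m of enat n\<^sub>0 \<Rightarrow> threshold n\<^sub>0 0 | \<infinity> \<Rightarrow> (\<lambda>_. 1))"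

definition pure_threshold_strategies :: "strategy set" where
  "pure_threshold_strategies = range pure_threshold"

definition mixed_threshold_strategies :: "strategy set" where
  "mixed_threshold_strategies = {threshold n\<^sub>0 \<theta> | n\<^sub>0 \<theta>. 0 < \<theta> \<and> \<theta> < 1}"

definition threshold_strategies :: "strategy set" where
  "threshold_strategies =
     {threshold n\<^sub>0 \<theta> | n\<^sub>0 \<theta>. 0 \<le> \<theta> \<and> \<theta> \<le> 1} \<union> {pure_threshold \<infinity>}"

section \<open>The Markov chain and the payoffs\<close>

text \<open>
  Stationarity of a probability distribution is expressed by the global balance equations,
  where \<open>Q x y\<close> is the transition rate from \<open>x\<close> to \<open>y \<noteq> x\<close> (diagonal entries are ignored).
  For chains with bounded exit rates, such as the one below, this is equivalent to invariance
  under the transition semigroup.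
\<close>

definition stationary :: "('x \<Rightarrow> 'x \<Rightarrow> real) \<Rightarrow> 'x pmf \<Rightarrow> bool" where
  "stationary Q p \<longleftrightarrow>
     (\<forall>y. ((\<lambda>x. pmf p x * Q x y) has_sum (pmf p y * (\<Sum>\<^sub>\<infinity>z\<in>-{y}. Q y z))) (-{y}))"

fun rate :: "clearing_model \<Rightarrow> strategy \<Rightarrow> nat \<times> env \<Rightarrow> nat \<times> env \<Rightarrow> real" where
  "rate M s (n, e) (n', e') =
     (if e' = e \<and> n' = Suc n then arr M e * s n
      else if e' = e \<and> n' = 0 \<and> n \<ge> 1 then vis M e
      else if e' = other e \<and> n' = n then sw M e
      else 0)"

definition p_ao :: "clearing_model \<Rightarrow> strategy \<Rightarrow> (nat \<times> env) pmf" where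
  "p_ao M s = (THE p. stationary (rate M s) p)"

text \<open>\<open>\<lambda>\<^sub>e p(n,e;s)\<close>: the rate at which customers arrive to find \<open>n\<close> present and environment \<open>e\<close>.\<close>

definition arr_flow :: "clearing_model \<Rightarrow> strategy \<Rightarrow> nat \<Rightarrow> env \<Rightarrow> real" where
  "arr_flow M s n e = arr M e * pmf (p_ao M s) (n, e)"

definition find_prob :: "clearing_model \<Rightarrow> strategy \<Rightarrow> nat \<Rightarrow> real" where
  "find_prob M s n =
     (arr_flow M s n E1 + arr_flow M s n E2) /
     (\<Sum>\<^sub>\<infinity>m\<in>UNIV. arr_flow M s m E1 + arr_flow M s m E2)"

definition K :: "clearing_model \<Rightarrow> real" where
  "K M = vis M E1 * vis M E2 + vis M E1 * sw M E2 + vis M E2 * sw M E1"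

text \<open>Mean time to the next visit, starting from environment \<open>e\<close>.\<close>

definition T :: "clearing_model \<Rightarrow> env \<Rightarrow> real" where
  "T M e = (vis M (other e) + sw M E2 + sw M E1) / K M"

text \<open>Only meaningful when \<open>find_prob M s n > 0\<close>.\<close>

definition S_ao :: "clearing_model \<Rightarrow> strategy \<Rightarrow> nat \<Rightarrow> real" where
  "S_ao M s n = reward M - cost M *
     ((arr_flow M s n E1 * T M E1 + arr_flow M s n E2 * T M E2) /
      (arr_flow M s n E1 + arr_flow M s n E2))"

text \<open>Payoff of a tagged customer who uses \<open>s'\<close> while all others use \<open>s\<close>.\<close>

definition payoff :: "clearing_model \<Rightarrow> strategy \<Rightarrow> strategy \<Rightarrow> real" where
  "payoff M s' s = (\<Sum>\<^sub>\<infinity>n\<in>{n. find_prob M s n > 0}. find_prob M s n * s' n * S_ao M s n)"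

definition equilibrium :: "clearing_model \<Rightarrow> strategy \<Rightarrow> bool" where
  "equilibrium M s \<longleftrightarrow> s \<in> strategies \<and> (\<forall>s'\<in>strategies. payoff M s s \<ge> payoff M s' s)"

section \<open>The functions \<open>F\<close>, \<open>G\<close>, \<open>H\<^sup>U\<close> and the critical thresholds\<close>

definition p_E :: "clearing_model \<Rightarrow> env \<Rightarrow> real" where
  "p_E M e = sw M (other e) / (sw M E1 + sw M E2)"

definition Delta :: "clearing_model \<Rightarrow> real" where
  "Delta M = (arr M E2 * (vis M E1 + sw M E1) - arr M E1 * (vis M E2 + sw M E2))^2
     + 4 * arr M E1 * arr M E2 * sw M E1 * sw M E2"

definition z1 :: "clearing_model \<Rightarrow> real" where
  "z1 M = (- arr M E1 * (vis M E2 + sw M E2) - arr M E2 * (vis M E1 + sw M E1) + sqrt (Delta M))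
     / (2 * arr M E1 * arr M E2)"

definition z2 :: "clearing_model \<Rightarrow> real" where
  "z2 M = (- arr M E1 * (vis M E2 + sw M E2) - arr M E2 * (vis M E1 + sw M E1) - sqrt (Delta M))
     / (2 * arr M E1 * arr M E2)"

text \<open>\<open>coef_A M e\<close> and \<open>coef_B M e\<close> are \<open>A\<^sub>e\<close> and \<open>B\<^sub>e\<close>.\<close>

definition coef_A :: "clearing_model \<Rightarrow> env \<Rightarrow> real" where
  "coef_A M e = (vis M e * arr M (other e) * z1 M + K M) * p_E M e
     / (sqrt (Delta M) * (1 - z1 M))"

definition coef_B :: "clearing_model \<Rightarrow> env \<Rightarrow> real" where
  "coef_B M e = - ((vis M e * arr M (other e) * z2 M + K M) * p_E M e
     / (sqrt (Delta M) * (1 - z2 M)))"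

definition tot_A :: "clearing_model \<Rightarrow> real" where
  "tot_A M = arr M E1 * coef_A M E1 * T M E1 + arr M E2 * coef_A M E2 * T M E2"

definition tot_B :: "clearing_model \<Rightarrow> real" where
  "tot_B M = arr M E1 * coef_B M E1 * T M E1 + arr M E2 * coef_B M E2 * T M E2"

definition tot_D :: "clearing_model \<Rightarrow> real" where
  "tot_D M = arr M E1 * coef_A M E1 + arr M E2 * coef_A M E2"

definition tot_E :: "clearing_model \<Rightarrow> real" where
  "tot_E M = arr M E1 * coef_B M E1 + arr M E2 * coef_B M E2"

definition F :: "clearing_model \<Rightarrow> nat \<Rightarrow> real \<Rightarrow> real" where
  "F M n \<theta> = (\<Sum>\<^sub>\<infinity>i\<in>{n..}. (1 - \<theta>) ^ (i - n) *
     ((reward M * tot_D M - cost M * tot_A M) * (1 / (1 - z1 M)) ^ i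
      + (reward M * tot_E M - cost M * tot_B M) * (1 / (1 - z2 M)) ^ i))"

definition G :: "clearing_model \<Rightarrow> nat \<Rightarrow> real \<Rightarrow> real" where
  "G M n \<theta> = (\<Sum>\<^sub>\<infinity>i\<in>{n..}. (1 - \<theta>) ^ (i - n) *
     (tot_D M * (1 / (1 - z1 M)) ^ i + tot_E M * (1 / (1 - z2 M)) ^ i))"

definition H_U :: "clearing_model \<Rightarrow> nat \<Rightarrow> real" where
  "H_U M n = F M n 1 / G M n 1"

text \<open>In \<^typ>\<open>enat\<close> the infimum of the empty set is \<open>\<infinity>\<close>.\<close>

definition n_U :: "clearing_model \<Rightarrow> enat" where
  "n_U M = Inf (enat ` {n. F M n 1 < 0})"

definition n_L :: "clearing_model \<Rightarrow> enat" where
  "n_L M = Inf (enat ` {n. F M n 0 \<le> 0})"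

definition n_U_minus :: "clearing_model \<Rightarrow> enat" where
  "n_U_minus M = Inf (enat ` {n. F M n 1 \<le> 0})"

definition n_L_plus :: "clearing_model \<Rightarrow> enat" where
  "n_L_plus M = Inf (enat ` {n. F M n 0 < 0})"

text \<open>
  The index set \<open>{n\<^sub>L\<^sup>+, \<dots>, n\<^sub>U\<^sup>- - 1}\<close>, written with a strict upper bound because subtraction
  would truncate when \<open>n\<^sub>U\<^sup>- = 0\<close>.
\<close>

definition mixed_range :: "clearing_model \<Rightarrow> nat set" where
  "mixed_range M = {n. n_L_plus M \<le> enat n \<and> enat n < n_U_minus M}"

definition theta_eq :: "clearing_model \<Rightarrow> nat \<Rightarrow> real" where
  "theta_eq M n\<^sub>0 = (THE \<theta>. 0 < \<theta> \<and> \<theta> < 1 \<and> F M n\<^sub>0 \<theta> = 0)"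

end

theory Submission
  imports Defs
begin

text \<open>
  A visit empties the system, so the balance equations never look further than one level down: the
  two unknowns \<open>p(n,1)\<close>, \<open>p(n,2)\<close> solve a linear system whose right-hand side is the flow of arrivals
  from level \<open>n - 1\<close>, and at level \<open>0\<close> it is the flow of visits, which depends only on the law of the
  environment. Each system is diagonally dominant, hence uniquely and nonnegatively solvable. So the
  chain has exactly one stationary distribution for every strategy of the population
  (\<open>stationary_exists\<close>, \<open>stationary_unique\<close>), and to find it one only has to guess a solution of the
  level recursion (\<open>p_ao_eqI\<close>).
  
  The payoff of a tagged customer is linear in each \<open>\<theta>'\<^sub>n\<close> separately. Hence a strategy is an
  equilibrium iff at each level it joins surely where the net benefit, weighted by the frequency of
  arrivals there, is positive and balks surely where it is negative (\<open>equilibrium_iff\<close>).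
  
  If everybody joins, the eigenvectors of the recursion give \<open>p(n,e) = A\<^sub>e a\<^sup>n + B\<^sub>e b\<^sup>n\<close> with
  \<open>a = 1/(1 - z\<^sub>1) > b = 1/(1 - z\<^sub>2)\<close>, and the weighted benefit at level \<open>n\<close> is \<open>F(n,1)\<close>. The chain for the
  threshold strategy with parameters \<open>n\<^sub>0\<close> and \<open>\<theta>\<close> is obtained from the always-join chain by deleting the
  customers who balk: it agrees with it below \<open>n\<^sub>0\<close>, and it sits at \<open>n\<^sub>0\<close> when \<open>i \<ge> n\<^sub>0\<close> customers would have
  been present but the last \<open>i - n\<^sub>0\<close> of them all balked, which has probability \<open>(1 - \<theta>)^(i - n\<^sub>0)\<close>. So the
  weighted benefits are \<open>F(n,1)\<close> for \<open>n < n\<^sub>0\<close>, \<open>F(n\<^sub>0,\<theta>)\<close> at \<open>n\<^sub>0\<close>, and \<open>F(n\<^sub>0,0) - F(n\<^sub>0,\<theta>)\<close> at \<open>n\<^sub>0 + 1\<close>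
  (\<open>net_flow_threshold\<close>). The equilibria among threshold strategies are thereby determined by the signs
  of \<open>F\<close>.
  
  The assumption \<open>(\<mu>\<^sub>1 - \<mu>\<^sub>2)(\<rho>\<^sub>1 - \<rho>\<^sub>2) < 0\<close> says exactly that the determinant \<open>A E - B D\<close> is positive
  (\<open>crowding_pos\<close>), and this makes \<open>H\<^sup>U(n) = F(n,1)/G(n,1)\<close> strictly decreasing: customers avoid the crowd.
  Consequently \<open>F(n,1)\<close> changes sign at most once as \<open>n\<close> grows, and so does its tail sum \<open>F(n,0)\<close>.
  Moreover, up to a positive factor, \<open>F(n,\<theta>)\<close> is affine in \<open>\<theta>\<close> (\<open>thinned_benefit_affine\<close>); therefore it has a
  root in \<open>(0,1)\<close>, and then only one, as soon as its values at \<open>\<theta> = 0\<close> and \<open>\<theta> = 1\<close> have opposite strict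
  signs. Comparing signs in the three cases gives the theorem.
\<close>

section \<open>The coupled pair of balance equations of a queue level\<close>

lemma other_other [simp]: "other (other e) = e"
  by (cases e) auto

lemma other_neq [simp]: "other e \<noteq> e" "e \<noteq> other e"
  by (cases e; simp)+

text \<open>
  Throughout this section \<open>x\<close> and \<open>x'\<close> stand for the masses of one level in the two environments, \<open>d\<close> and
  \<open>d'\<close> for their exit rates, \<open>q\<close> and \<open>q'\<close> for the switching rates and \<open>r\<close>, \<open>r'\<close> for the flow entering the level
  from below. Elimination shows that all information is in the sign of the determinant.
\<close>

lemma coupled_solution:
  fixes d d' q q' x x' r r' :: real
  assumes "d * x - q' * x' = r" "d' * x' - q * x = r'"
  shows "(d * d' - q * q') * x = d' * r + q' * r'"
  unfolding assms[symmetric] by (simp add: algebra_simps)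

lemma coupled_determinant_pos:
  fixes d d' q q' :: real
  assumes "0 < q" "q < d" "0 < q'" "q' < d'"
  shows "d * d' - q * q' > 0"
  using mult_strict_mono[of q d q' d'] assms by simp

lemma coupled_nonneg:
  fixes d d' q q' x x' r r' :: real
  assumes "d * x - q' * x' = r" "d' * x' - q * x = r'"
    and q: "0 < q" "q < d" "0 < q'" "q' < d'" and "0 \<le> r" "0 \<le> r'"
  shows "0 \<le> x"
proof -
  have "0 \<le> (d * d' - q * q') * x"
    unfolding coupled_solution[OF assms(1,2)] using assms by simp
  then show ?thesis
    using coupled_determinant_pos[OF q] by (simp add: zero_le_mult_iff)
qed

lemma coupled_pos:
  fixes d d' q q' x x' r r' :: real
  assumes "d * x - q' * x' = r" "d' * x' - q * x = r'"
    and q: "0 < q" "q < d" "0 < q'" "q' < d'" and "0 < r" "0 < r'"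
  shows "0 < x"
proof -
  have "0 < d' * r + q' * r'"
    using assms by (simp add: add_pos_pos)
  then have "0 < (d * d' - q * q') * x"
    unfolding coupled_solution[OF assms(1,2)] .
  then show ?thesis
    using coupled_determinant_pos[OF q] by (simp add: zero_less_mult_iff)
qed

lemma coupled_unique:
  fixes d d' q q' x x' y y' r r' :: real
  assumes "d * x - q' * x' = r" "d' * x' - q * x = r'"
    and "d * y - q' * y' = r" "d' * y' - q * y = r'"
    and q: "0 < q" "q < d" "0 < q'" "q' < d'"
  shows "x = y"
proof -
  have "(d * d' - q * q') * x = (d * d' - q * q') * y"
    using coupled_solution[OF assms(1,2)] coupled_solution[OF assms(3,4)] by simp
  then show ?thesis
    using coupled_determinant_pos[OF q] by simp
qed

lemma coupled_cramer:
  fixes d d' q q' r r' :: real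
  assumes q: "0 < q" "q < d" "0 < q'" "q' < d'"
  shows "d * ((d' * r + q' * r') / (d * d' - q * q')) - q' * ((d * r' + q * r) / (d' * d - q' * q)) = r"
proof -
  have nz: "d * d' - q * q' \<noteq> 0" using coupled_determinant_pos[OF q] by simp
  have "d * ((d' * r + q' * r') / (d * d' - q * q')) - q' * ((d * r' + q * r) / (d' * d - q' * q))
      = (d * (d' * r + q' * r') - q' * (d * r' + q * r)) / (d * d' - q * q')"
    by (simp add: diff_divide_distrib mult.commute)
  also have "d * (d' * r + q' * r') - q' * (d * r' + q * r) = r * (d * d' - q * q')"
    by (simp add: algebra_simps)
  finally show ?thesis using nz by simp
qed

locale clearing =
  fixes M :: clearing_model
  assumes valid: "valid_model M"
begin

lemma arr_pos [simp]: "arr M e > 0" and vis_pos [simp]: "vis M e > 0" and sw_pos [simp]: "sw M e > 0"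
  and cost_pos: "cost M > 0"
  using valid by (auto simp: valid_model_def)

lemma arr_nonneg [simp]: "arr M e \<ge> 0" and vis_nonneg [simp]: "vis M e \<ge> 0"
  and sw_nonneg [simp]: "sw M e \<ge> 0"
  by (simp_all add: less_imp_le)

lemma rates_nonzero [simp]: "arr M e \<noteq> 0" "vis M e \<noteq> 0" "sw M e \<noteq> 0"
  using arr_pos[of e] vis_pos[of e] sw_pos[of e] by linarith+

lemma p_E_pos [simp]: "p_E M e > 0"
  unfolding p_E_def by (simp add: add_pos_pos)

lemma p_E_balance: "sw M e * p_E M e = sw M (other e) * p_E M (other e)"
  by (simp add: p_E_def)

lemma p_E_sum: "p_E M E1 + p_E M E2 = 1"
proof -
  have "sw M E1 + sw M E2 \<noteq> 0" using sw_pos[of E1] sw_pos[of E2] by linarith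
  then show ?thesis by (simp add: p_E_def add.commute flip: add_divide_distrib)
qed

section \<open>Stationary distributions as solutions of a level recursion\<close>

text \<open>
  The masses \<open>m\<close> of the two environments are kept as a parameter: a stationary distribution first
  satisfies the recursion with its own environment marginals, and only summing the recursion shows that
  these are \<open>p_E M\<close>.
\<close>

definition inflow :: "(env \<Rightarrow> real) \<Rightarrow> strategy \<Rightarrow> (nat \<Rightarrow> env \<Rightarrow> real) \<Rightarrow> nat \<Rightarrow> env \<Rightarrow> real" where
  "inflow m s p n e = (case n of 0 \<Rightarrow> vis M e * m e | Suc k \<Rightarrow> arr M e * s k * p k e)"

lemma inflow_simps [simp]:
  "inflow m s p 0 e = vis M e * m e"
  "inflow m s p (Suc n) e = arr M e * s n * p n e"
  by (simp_all add: inflow_def)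

abbreviation exit_rate :: "strategy \<Rightarrow> nat \<Rightarrow> env \<Rightarrow> real" where
  "exit_rate s n e \<equiv> arr M e * s n + vis M e + sw M e"

definition balanced :: "(env \<Rightarrow> real) \<Rightarrow> strategy \<Rightarrow> (nat \<Rightarrow> env \<Rightarrow> real) \<Rightarrow> bool" where
  "balanced m s p \<longleftrightarrow> (\<forall>n e.
     exit_rate s n e * p n e - sw M (other e) * p n (other e) = inflow m s p n e)"

lemma balancedD:
  "balanced m s p \<Longrightarrow>
     exit_rate s n e * p n e - sw M (other e) * p n (other e) = inflow m s p n e"
  by (auto simp: balanced_def)

lemma sw_less_exit:
  assumes "s \<in> strategies"
  shows "sw M e < exit_rate s n e"
proof -
  have "0 \<le> arr M e * s n" using assms by (auto simp: strategies_def)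
  with vis_pos[of e] show ?thesis by linarith
qed

text \<open>
  Level by level, the inflow is known and the coupled pair has one solution.
\<close>

lemma balanced_unique:
  assumes s: "s \<in> strategies" and p: "balanced m s p" and p': "balanced m s p'"
  shows "p n e = p' n e"
proof -
  have step: "p n e = p' n e" if same: "\<And>e. inflow m s p n e = inflow m s p' n e" for n e
  proof (rule coupled_unique)
    show "exit_rate s n e * p n e - sw M (other e) * p n (other e) = inflow m s p n e"
      and "exit_rate s n (other e) * p n (other e) - sw M e * p n e = inflow m s p n (other e)"
      using balancedD[OF p, of e n] balancedD[OF p, of "other e" n] by simp_all
    show "exit_rate s n e * p' n e - sw M (other e) * p' n (other e) = inflow m s p n e"
      and "exit_rate s n (other e) * p' n (other e) - sw M e * p' n e = inflow m s p n (other e)"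
      using balancedD[OF p', of e n] balancedD[OF p', of "other e" n] by (simp_all add: same)
  qed (use sw_less_exit[OF s] in auto)
  show ?thesis
    by (induction n arbitrary: e) (auto intro!: step)
qed

lemma balanced_nonneg:
  assumes s: "s \<in> strategies" and p: "balanced (p_E M) s p"
  shows "p n e \<ge> 0"
proof -
  have step: "0 \<le> p n e" if "\<And>e. 0 \<le> inflow (p_E M) s p n e" for n e
    by (rule coupled_nonneg[OF balancedD[OF p] balancedD[OF p, of "other e" _, simplified other_other]])
       (use that sw_less_exit[OF s] in auto)
  show ?thesis
  proof (induction n arbitrary: e)
    case 0
    show ?case by (rule step) (simp add: less_imp_le)
  next
    case (Suc n)
    show ?case by (rule step) (use Suc s in \<open>auto simp: strategies_def\<close>)
  qed
qed

text \<open>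
  Levels reached with positive joining probabilities carry mass in both environments; positivity starts
  from the visits at level \<open>0\<close> and is carried up by the arrivals.
\<close>

lemma balanced_pos:
  assumes s: "s \<in> strategies" and p: "balanced (p_E M) s p" and "\<And>i. i < n \<Longrightarrow> s i > 0"
  shows "p n e > 0"
proof -
  have step: "0 < p n e" if "\<And>e. 0 < inflow (p_E M) s p n e" for n e
    by (rule coupled_pos[OF balancedD[OF p] balancedD[OF p, of "other e" _, simplified other_other]])
       (use that sw_less_exit[OF s] in auto)
  show ?thesis using assms(3)
  proof (induction n arbitrary: e)
    case 0
    show ?case by (rule step) simp
  next
    case (Suc n)
    show ?case by (rule step) (use Suc in auto)
  qed
qed

text \<open>
  Adding up the levels \<open>0, \<dots>, n\<close> telescopes the arrival flows; only the one leaving level \<open>n\<close> survives.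
\<close>

lemma balanced_partial_sum:
  assumes "balanced m s p"
  shows "(vis M e + sw M e) * (\<Sum>i\<le>n. p i e) - sw M (other e) * (\<Sum>i\<le>n. p i (other e))
       = vis M e * m e - arr M e * s n * p n e"
proof (induction n)
  case 0
  show ?case using balancedD[OF assms, of e 0] by (simp add: algebra_simps)
next
  case (Suc n)
  then show ?case using balancedD[OF assms, of e "Suc n"] by (simp add: algebra_simps)
qed

text \<open>
  In the limit the surviving arrival flow vanishes, because \<open>s\<close> is bounded and the terms of a convergent
  series tend to zero. What remains is a coupled pair for the total masses \<open>S\<close>.
\<close>

lemma balanced_total:
  assumes s: "s \<in> strategies" and p: "balanced m s p" and S: "\<And>e. (\<lambda>n. p n e) sums S e"
  shows "(vis M e + sw M e) * S e - sw M (other e) * S (other e) = vis M e * m e"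
proof (rule LIMSEQ_unique)
  have lim: "(\<lambda>n. \<Sum>i\<le>n. p i e) \<longlonglongrightarrow> S e" for e
    using S by (simp add: sums_def_le)
  show "(\<lambda>n. (vis M e + sw M e) * (\<Sum>i\<le>n. p i e) - sw M (other e) * (\<Sum>i\<le>n. p i (other e)))
      \<longlonglongrightarrow> (vis M e + sw M e) * S e - sw M (other e) * S (other e)"
    by (intro tendsto_intros lim)
  have "(\<lambda>n. p n e) \<longlonglongrightarrow> 0"
    using S summable_LIMSEQ_zero sums_summable by blast
  moreover have "norm (s n) \<le> 1" for n
    using s by (auto simp: strategies_def)
  ultimately have "(\<lambda>n. s n * p n e) \<longlonglongrightarrow> 0"
    by (intro lim_null_mult_left_bounded[where B = 1] always_eventually allI) auto
  then have "(\<lambda>n. vis M e * m e - arr M e * (s n * p n e)) \<longlonglongrightarrow> vis M e * m e - arr M e * 0"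
    by (intro tendsto_intros)
  then show "(\<lambda>n. (vis M e + sw M e) * (\<Sum>i\<le>n. p i e) - sw M (other e) * (\<Sum>i\<le>n. p i (other e)))
      \<longlonglongrightarrow> vis M e * m e"
    unfolding balanced_partial_sum[OF p] by (simp add: mult.assoc)
qed

text \<open>
  The deficit \<open>p_E M e - (\<Sum>i\<le>n. p i e)\<close> of the partial sums again solves a coupled pair, driven by the
  nonnegative flow out of level \<open>n\<close>. So the partial sums are bounded, which gives convergence, and the
  equation for the totals identifies the limit.
\<close>

lemma balanced_has_sum:
  assumes s: "s \<in> strategies" and p: "balanced (p_E M) s p"
  shows "((\<lambda>n. p n e) has_sum p_E M e) UNIV"
proof -
  note nonneg = balanced_nonneg[OF s p]
  have bound: "(\<Sum>i\<le>n. p i e) \<le> p_E M e" for n e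
  proof -
    have *: "(vis M e + sw M e) * (p_E M e - (\<Sum>i\<le>n. p i e))
        - sw M (other e) * (p_E M (other e) - (\<Sum>i\<le>n. p i (other e))) = arr M e * s n * p n e" for e
      using balanced_partial_sum[OF p, of e n] p_E_balance[of e] by (simp add: algebra_simps)
    have "0 \<le> p_E M e - (\<Sum>i\<le>n. p i e)"
      by (rule coupled_nonneg[OF *[of e] *[of "other e", simplified other_other]])
         (use s nonneg in \<open>auto simp: strategies_def\<close>)
    then show ?thesis by simp
  qed
  have "summable (\<lambda>n. p n e)" for e
  proof (rule summableI_nonneg_bounded)
    show "(\<Sum>i<n. p i e) \<le> p_E M e" for n
      using bound[where n = "n - 1" and e = e] p_E_pos[of e]
      by (cases n) (auto simp: lessThan_Suc_atMost less_imp_le)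
  qed (rule nonneg)
  then have S: "(\<lambda>n. p n e) sums (\<Sum>n. p n e)" for e
    by (rule summable_sums)
  note total = balanced_total[OF s p, of "\<lambda>e. \<Sum>n. p n e", OF S]
  \<comment> \<open>The environment law solves the pair that the totals solve.\<close>
  have env: "(vis M e + sw M e) * p_E M e - sw M (other e) * p_E M (other e) = vis M e * p_E M e" for e
    using p_E_balance[of e] by (simp add: algebra_simps)
  have "(\<Sum>n. p n e) = p_E M e"
    by (rule coupled_unique[OF total[of e] total[of "other e", simplified other_other]
          env[of e] env[of "other e", simplified other_other]]) auto
  with S[of e] show ?thesis
    using nonneg sums_nonneg_imp_has_sum by metis
qed

definition level_solution :: "strategy \<Rightarrow> nat \<Rightarrow> (env \<Rightarrow> real) \<Rightarrow> env \<Rightarrow> real" where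
  "level_solution s n r e =
     (exit_rate s n (other e) * r e + sw M (other e) * r (other e))
     / (exit_rate s n e * exit_rate s n (other e) - sw M e * sw M (other e))"

primrec level_dist :: "strategy \<Rightarrow> nat \<Rightarrow> env \<Rightarrow> real" where
  "level_dist s 0 = level_solution s 0 (\<lambda>e. vis M e * p_E M e)"
| "level_dist s (Suc n) = level_solution s (Suc n) (\<lambda>e. arr M e * s n * level_dist s n e)"

lemma level_dist_balanced:
  assumes s: "s \<in> strategies"
  shows "balanced (p_E M) s (level_dist s)"
  unfolding balanced_def
proof (intro allI)
  fix n e
  show "exit_rate s n e * level_dist s n e
      - sw M (other e) * level_dist s n (other e) = inflow (p_E M) s (level_dist s) n e"
    using coupled_cramer[OF sw_pos[of e] sw_less_exit[OF s, of e n]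
        sw_pos[of "other e"] sw_less_exit[OF s, of "other e" n]]
    by (cases n) (simp_all add: level_solution_def)
qed


section \<open>The stationary distribution of the chain\<close>

text \<open>
  A visit at level \<open>0\<close> does not change the state and thus is no transition; this is the reason for the case
  distinction.
\<close>

lemma exit_flow:
  "(\<Sum>\<^sub>\<infinity>z\<in>-{(n, e)}. rate M s (n, e) z)
     = arr M e * s n + (if n = 0 then 0 else vis M e) + sw M e"
proof (rule infsumI, rule has_sum_finite_neutralI)
  let ?B = "{(Suc n, e), (n, other e)} \<union> (if n = 0 then {} else {(0, e)})"
  show "finite ?B" "?B \<subseteq> - {(n, e)}" by auto
  show "rate M s (n, e) z = 0" if "z \<in> - {(n, e)} - ?B" for z
    using that by (cases z; simp split: if_splits; auto)
  show "arr M e * s n + (if n = 0 then 0 else vis M e) + sw M e = (\<Sum>z\<in>?B. rate M s (n, e) z)"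
    by simp
qed

definition env_mass :: "(nat \<times> env) pmf \<Rightarrow> env \<Rightarrow> real" where
  "env_mass p e = (\<Sum>\<^sub>\<infinity>n. pmf p (n, e))"

lemma pmf_summable_on: "pmf p summable_on A"
  using pmf_abs_summable[of p A] by (simp add: abs_summable_equivalent[symmetric])

lemma env_mass_has_sum: "((\<lambda>n. pmf p (n, e)) has_sum env_mass p e) UNIV"
proof -
  have "pmf p summable_on range (\<lambda>n. (n, e))" by (rule pmf_summable_on)
  then have "(\<lambda>n. pmf p (n, e)) summable_on UNIV"
    by (subst (asm) summable_on_reindex) (auto simp: inj_on_def o_def)
  then show ?thesis by (simp add: env_mass_def)
qed

lemma has_sum_states:
  fixes f :: "nat \<times> env \<Rightarrow> real"
  assumes "\<And>e. ((\<lambda>n. f (n, e)) has_sum S e) UNIV"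
  shows "(f has_sum (S E1 + S E2)) UNIV"
proof -
  have row: "(f has_sum S e) (range (\<lambda>n. (n, e)))" for e
    using assms[of e] by (subst has_sum_reindex) (auto simp: inj_on_def o_def)
  have "(UNIV :: (nat \<times> env) set) = range (\<lambda>n. (n, E1)) \<union> range (\<lambda>n. (n, E2))"
    using env.exhaust by auto blast
  moreover have "range (\<lambda>n. (n, E1)) \<inter> range (\<lambda>n. (n, E2)) = ({} :: (nat \<times> env) set)" by auto
  ultimately show ?thesis
    using has_sum_Un_disjoint[OF row[of E1] row[of E2]] by simp
qed

lemma env_mass_sum: "env_mass p E1 + env_mass p E2 = 1"
proof -
  have "(pmf p has_sum (env_mass p E1 + env_mass p E2)) UNIV"
    using has_sum_states[of "pmf p"] env_mass_has_sum by blast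
  moreover have "infsum (pmf p) UNIV = 1"
    using infsetsum_infsum[OF pmf_abs_summable[of p UNIV]] infsetsum_pmf_eq_1[of p UNIV] by simp
  ultimately show ?thesis by (simp add: infsumI)
qed

lemma rate_into_0:
  "rate M s (k, e') (0, e) =
     (if e' = e then (if k = 0 then 0 else vis M e)
      else if k = 0 then sw M (other e) else 0)"
  by (cases e; cases e'; simp)

lemma rate_into_Suc:
  "rate M s (k, e') (Suc n, e) =
     (if e' = e then (if k = n then arr M e * s n else 0)
      else if k = Suc n then sw M (other e) else 0)"
  by (cases e; cases e'; simp)

lemma not_eq_iff_other: "e' \<noteq> e \<longleftrightarrow> e' = other e"
  by (cases e; cases e'; simp)

lemma entry_flow_Suc:
  "((\<lambda>x. pmf p x * rate M s x (Suc n, e)) has_sum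
      (arr M e * s n * pmf p (n, e) + sw M (other e) * pmf p (Suc n, other e))) (-{(Suc n, e)})"
proof (rule has_sum_finite_neutralI)
  let ?B = "{(n, e), (Suc n, other e)}"
  show "finite ?B" "?B \<subseteq> - {(Suc n, e)}" by simp_all
  show "pmf p x * rate M s x (Suc n, e) = 0" if "x \<in> - {(Suc n, e)} - ?B" for x
  proof (cases x)
    case (Pair k e')
    then show ?thesis using that by (simp only: rate_into_Suc) (cases "e' = e"; auto simp: not_eq_iff_other)
  qed
  show "arr M e * s n * pmf p (n, e) + sw M (other e) * pmf p (Suc n, other e)
      = (\<Sum>x\<in>?B. pmf p x * rate M s x (Suc n, e))"
    by (simp add: rate_into_Suc mult.commute del: rate.simps)
qed

lemma entry_flow_0:
  "((\<lambda>x. pmf p x * rate M s x (0, e)) has_sum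
      (vis M e * env_mass p e - vis M e * pmf p (0, e) + sw M (other e) * pmf p (0, other e))) (-{(0, e)})"
proof -
  let ?f = "\<lambda>x. pmf p x * rate M s x (0, e)"
  let ?S = "vis M e * env_mass p e + - (vis M e * pmf p (0, e))"
  have "((\<lambda>n. vis M e * pmf p (n, e) + (if n = 0 then - (vis M e * pmf p (0, e)) else 0)) has_sum ?S) UNIV"
    by (intro has_sum_add has_sum_cmult_right env_mass_has_sum
        has_sum_finite_neutralI[where B = "{0}"]) simp_all
  also have "(\<lambda>n. vis M e * pmf p (n, e) + (if n = 0 then - (vis M e * pmf p (0, e)) else 0))
      = (\<lambda>n. ?f (n, e))"
    by (simp add: fun_eq_iff rate_into_0 del: rate.simps)
  finally have "(?f has_sum ?S) (range (\<lambda>n. (n, e)))"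
    by (subst has_sum_reindex) (simp_all add: inj_on_def o_def del: rate.simps)
  then have "(?f has_sum (?f (0, other e) + ?S)) (insert (0, other e) (range (\<lambda>n. (n, e))))"
    by (intro has_sum_insert) (simp_all add: image_iff del: rate.simps)
  also have "?this \<longleftrightarrow> (?f has_sum (?f (0, other e) + ?S)) (-{(0, e)})"
  proof (rule has_sum_cong_neutral)
    fix x :: "nat \<times> env" assume "x \<in> - {(0, e)} - insert (0, other e) (range (\<lambda>n. (n, e)))"
    then show "?f x = 0"
      by (cases x) (auto simp: rate_into_0 not_eq_iff_other image_iff simp del: rate.simps)
  next
    fix x :: "nat \<times> env" assume "x \<in> insert (0, other e) (range (\<lambda>n. (n, e))) - - {(0, e)}"
    then show "?f x = 0" by (auto simp: rate_into_0 simp del: rate.simps)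
  qed simp
  finally show ?thesis by (simp add: rate_into_0 algebra_simps del: rate.simps)
qed

text \<open>
  At level \<open>0\<close> the visits bring in \<open>vis M e\<close> times the mass of the levels \<open>n \<ge> 1\<close>. Adding the term of level
  \<open>0\<close> on both sides gives the exit rate \<open>exit_rate s 0 e\<close> and the inflow \<open>vis M e * env_mass p e\<close>, so that
  level \<open>0\<close> has the same form as the others.
\<close>

lemma stationary_iff_balanced:
  "stationary (rate M s) p \<longleftrightarrow> balanced (env_mass p) s (\<lambda>n e. pmf p (n, e))"
proof -
  have flow: "((\<lambda>x. pmf p x * rate M s x (n, e)) has_sum
        (pmf p (n, e) * (\<Sum>\<^sub>\<infinity>z\<in>-{(n, e)}. rate M s (n, e) z))) (-{(n, e)}) \<longleftrightarrow>
      exit_rate s n e * pmf p (n, e) - sw M (other e) * pmf p (n, other e)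
        = inflow (env_mass p) s (\<lambda>n e. pmf p (n, e)) n e" (is "(?f has_sum ?out) _ \<longleftrightarrow> ?bal") for n e
  proof -
    obtain in_flow where in_flow: "(?f has_sum in_flow) (-{(n, e)})"
        "in_flow = ?out \<longleftrightarrow> ?bal"
    proof (cases n)
      case 0
      show ?thesis
        by (rule that[unfolded 0, OF entry_flow_0]) (auto simp: exit_flow algebra_simps)
    next
      case (Suc k)
      show ?thesis
        by (rule that[unfolded Suc, OF entry_flow_Suc]) (auto simp: exit_flow algebra_simps)
    qed
    then show ?thesis using has_sum_unique by blast
  qed
  show ?thesis
    unfolding stationary_def balanced_def split_paired_All flow ..
qed

text \<open>
  Summing the balance equations over all levels leaves the balance equation of the two-state
  environment, and the two masses add up to \<open>1\<close>.
\<close>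

lemma stationary_env_mass:
  assumes s: "s \<in> strategies" and stat: "stationary (rate M s) p"
  shows "env_mass p = p_E M"
proof -
  have "sw M e * env_mass p e = sw M (other e) * env_mass p (other e)" for e
    using balanced_total[OF s stat[unfolded stationary_iff_balanced], of "env_mass p"]
      has_sum_imp_sums[OF env_mass_has_sum] by (simp add: algebra_simps)
  from this[of E1] have "sw M E1 * env_mass p E1 = sw M E2 * env_mass p E2" by simp
  then have "(sw M E1 + sw M E2) * env_mass p E1 = sw M E2 * (env_mass p E1 + env_mass p E2)"
    "(sw M E1 + sw M E2) * env_mass p E2 = sw M E1 * (env_mass p E1 + env_mass p E2)"
    by (simp_all add: distrib_left distrib_right)
  then have "(sw M E1 + sw M E2) * env_mass p E1 = sw M E2"
    "(sw M E1 + sw M E2) * env_mass p E2 = sw M E1"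
    unfolding env_mass_sum by simp_all
  moreover have "sw M E1 + sw M E2 \<noteq> 0" using sw_pos[of E1] sw_pos[of E2] by linarith
  ultimately have "env_mass p E1 = p_E M E1" "env_mass p E2 = p_E M E2"
    by (simp_all add: p_E_def field_simps)
  then have "env_mass p e = p_E M e" for e by (cases e) simp_all
  then show ?thesis by (simp add: ext)
qed

lemma stationary_unique:
  assumes s: "s \<in> strategies" and p: "stationary (rate M s) p" and p': "stationary (rate M s) p'"
  shows "p = p'"
proof (rule pmf_eqI)
  fix x :: "nat \<times> env"
  have bal: "balanced (p_E M) s (\<lambda>n e. pmf p (n, e))" if "stationary (rate M s) p" for p
    using that stationary_env_mass[OF s that] by (simp add: stationary_iff_balanced)
  show "pmf p x = pmf p' x"
    using balanced_unique[OF s bal[OF p] bal[OF p'], of "fst x" "snd x"] by simp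
qed

lemma stationary_exists:
  assumes s: "s \<in> strategies"
  shows "\<exists>p. stationary (rate M s) p"
proof -
  let ?f = "\<lambda>x. level_dist s (fst x) (snd x)"
  note bal = level_dist_balanced[OF s]
  have nonneg: "0 \<le> ?f x" for x by (rule balanced_nonneg[OF s bal])
  have sum: "(?f has_sum 1) UNIV"
  proof -
    have "(?f has_sum (p_E M E1 + p_E M E2)) UNIV"
      by (rule has_sum_states) (simp add: balanced_has_sum[OF s bal])
    then show ?thesis by (simp add: p_E_sum)
  qed
  have "Infinite_Sum.abs_summable_on ?f UNIV"
    using has_sum_imp_summable[OF sum] nonneg by (simp only: real_norm_def abs_of_nonneg)
  then have abs: "Infinite_Set_Sum.abs_summable_on ?f UNIV"
    by (rule abs_summable_equivalent[THEN iffD1])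
  have "(\<integral>\<^sup>+x. ennreal (?f x) \<partial>count_space UNIV) = 1"
    using nn_integral_conv_infsetsum[OF abs nonneg]
    unfolding infsetsum_infsum[OF abs] infsumI[OF sum] by simp
  then have pmf: "pmf (embed_pmf ?f) x = ?f x" for x
    using nonneg by (intro pmf_embed_pmf)
  have "env_mass (embed_pmf ?f) = p_E M"
    unfolding env_mass_def pmf fst_conv snd_conv
    by (intro ext infsumI balanced_has_sum[OF s bal])
  then have "stationary (rate M s) (embed_pmf ?f)"
    unfolding stationary_iff_balanced pmf using bal by simp
  then show ?thesis ..
qed

lemma p_ao_balanced:
  assumes s: "s \<in> strategies"
  shows "balanced (p_E M) s (\<lambda>n e. pmf (p_ao M s) (n, e))"
proof -
  have "\<exists>!p. stationary (rate M s) p"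
    using stationary_exists[OF s] stationary_unique[OF s] by blast
  then have "stationary (rate M s) (p_ao M s)"
    unfolding p_ao_def by (rule theI')
  then show ?thesis
    using stationary_env_mass[OF s, of "p_ao M s"] unfolding stationary_iff_balanced by simp
qed

text \<open>
  This is how stationary distributions are computed below: any solution of the recursion is the right one,
  with no need to check nonnegativity or normalisation.
\<close>

lemma p_ao_eqI:
  assumes "s \<in> strategies" and "balanced (p_E M) s p"
  shows "pmf (p_ao M s) (n, e) = p n e"
  by (rule balanced_unique[OF assms(1) p_ao_balanced[OF assms(1)] assms(2)])

section \<open>Equilibria as pointwise best responses\<close>

text \<open>
  The net benefit of joining at level \<open>n\<close>, weighted by the rate of arrivals that see \<open>n\<close>. Unlike
  \<open>S_ao M s n\<close>, it makes sense for levels that are never seen, where it is \<open>0\<close>.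
\<close>

definition net_flow :: "strategy \<Rightarrow> nat \<Rightarrow> real" where
  "net_flow s n = (reward M - cost M * T M E1) * arr_flow M s n E1
                + (reward M - cost M * T M E2) * arr_flow M s n E2"

definition arrival_rate :: "strategy \<Rightarrow> real" where
  "arrival_rate s = (\<Sum>\<^sub>\<infinity>m. arr_flow M s m E1 + arr_flow M s m E2)"

lemma arr_flow_nonneg: "0 \<le> arr_flow M s n e"
  by (simp add: arr_flow_def)

lemma arr_flow_summable: "(\<lambda>n. arr_flow M s n e) summable_on UNIV"
  unfolding arr_flow_def
  by (intro summable_on_cmult_right has_sum_imp_summable[OF env_mass_has_sum])

lemma arrival_rate_pos:
  assumes s: "s \<in> strategies"
  shows "0 < arrival_rate s"
proof -
  have sum: "((\<lambda>n. arr_flow M s n e) has_sum arr M e * p_E M e) UNIV" for e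
    unfolding arr_flow_def
    by (intro has_sum_cmult_right balanced_has_sum[OF s p_ao_balanced[OF s]])
  have "arrival_rate s = arr M E1 * p_E M E1 + arr M E2 * p_E M E2"
    unfolding arrival_rate_def by (intro infsumI has_sum_add sum)
  also have "\<dots> > 0" by (simp add: add_pos_pos)
  finally show ?thesis .
qed

text \<open>
  Levels with \<open>find_prob M s n = 0\<close> may be included in the sum since their flows vanish, and for the
  others the denominator of \<open>S_ao\<close> cancels.
\<close>

lemma payoff_terms:
  assumes s: "s \<in> strategies"
  shows "payoff M s' s = (\<Sum>\<^sub>\<infinity>n. s' n * net_flow s n / arrival_rate s)"
  unfolding payoff_def
proof (rule infsum_cong_neutral)
  fix n
  have find: "find_prob M s n = (arr_flow M s n E1 + arr_flow M s n E2) / arrival_rate s"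
    by (simp add: find_prob_def arrival_rate_def)
  {
    assume "n \<in> UNIV - {n. 0 < find_prob M s n}"
    then have "arr_flow M s n E1 + arr_flow M s n E2 \<le> 0"
      using arrival_rate_pos[OF s] by (simp add: find zero_less_divide_iff not_less)
    then have "arr_flow M s n E1 = 0" "arr_flow M s n E2 = 0"
      using arr_flow_nonneg[of s n E1] arr_flow_nonneg[of s n E2] by linarith+
    then show "s' n * net_flow s n / arrival_rate s = 0" by (simp add: net_flow_def)
  next
    assume "n \<in> {n. 0 < find_prob M s n} \<inter> UNIV"
    then have "arr_flow M s n E1 + arr_flow M s n E2 \<noteq> 0" by (auto simp: find)
    then have "(arr_flow M s n E1 + arr_flow M s n E2) * S_ao M s n
        = reward M * (arr_flow M s n E1 + arr_flow M s n E2)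
          - cost M * (arr_flow M s n E1 * T M E1 + arr_flow M s n E2 * T M E2)"
      unfolding S_ao_def right_diff_distrib by simp
    also have "\<dots> = net_flow s n" by (simp add: net_flow_def algebra_simps)
    finally have "(arr_flow M s n E1 + arr_flow M s n E2) * S_ao M s n = net_flow s n" .
    then show "find_prob M s n * s' n * S_ao M s n = s' n * net_flow s n / arrival_rate s"
      by (simp add: find mult.assoc mult.left_commute)
  }
qed simp

lemma payoff_summable:
  assumes s': "s' \<in> strategies"
  shows "(\<lambda>n. s' n * net_flow s n / arrival_rate s) summable_on UNIV"
proof -
  let ?c = "\<lambda>e. \<bar>reward M - cost M * T M e\<bar>"
  have "(\<lambda>n. s' n * net_flow s n) summable_on UNIV"
  proof (rule summable_on_iff_abs_summable_on_real[THEN iffD2], rule summable_on_comparison_test)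
    show "(\<lambda>n. ?c E1 * arr_flow M s n E1 + ?c E2 * arr_flow M s n E2) summable_on UNIV"
      by (intro summable_on_add summable_on_cmult_right arr_flow_summable)
    show "norm (s' n * net_flow s n) \<le> ?c E1 * arr_flow M s n E1 + ?c E2 * arr_flow M s n E2" for n
    proof -
      have "norm (s' n * net_flow s n) \<le> \<bar>net_flow s n\<bar>"
        using s' by (auto simp: abs_mult strategies_def intro!: mult_left_le_one_le)
      also have "\<dots> \<le> ?c E1 * arr_flow M s n E1 + ?c E2 * arr_flow M s n E2"
        unfolding net_flow_def
        by (rule order_trans[OF abs_triangle_ineq]) (simp add: abs_mult arr_flow_nonneg)
      finally show ?thesis .
    qed
  qed simp
  then show ?thesis
    using summable_on_cmult_left[of "\<lambda>n. s' n * net_flow s n" UNIV "inverse (arrival_rate s)"]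
    by (simp add: divide_inverse)
qed

text \<open>
  Changing the joining probability at a single level changes a single term of the payoff.
\<close>

lemma payoff_change_one:
  assumes s: "s \<in> strategies"
  shows "payoff M (s(n := v)) s = payoff M s s + (v - s n) * net_flow s n / arrival_rate s"
proof -
  let ?\<delta> = "(v - s n) * net_flow s n / arrival_rate s"
  have "((\<lambda>k. s k * net_flow s k / arrival_rate s + (if k = n then ?\<delta> else 0))
      has_sum (payoff M s s + ?\<delta>)) UNIV"
  proof (rule has_sum_add)
    show "((\<lambda>k. s k * net_flow s k / arrival_rate s) has_sum payoff M s s) UNIV"
      unfolding payoff_terms[OF s] by (rule has_sum_infsum[OF payoff_summable[OF s]])
    show "((\<lambda>k. if k = n then ?\<delta> else 0) has_sum ?\<delta>) UNIV"
      by (rule has_sum_finite_neutralI[where B = "{n}"]) auto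
  qed
  also have "(\<lambda>k. s k * net_flow s k / arrival_rate s + (if k = n then ?\<delta> else 0))
      = (\<lambda>k. (s(n := v)) k * net_flow s k / arrival_rate s)"
    by (auto simp: fun_eq_iff left_diff_distrib diff_divide_distrib)
  finally show ?thesis
    unfolding payoff_terms[OF s, of "s(n := v)"] by (rule infsumI)
qed

text \<open>
  Necessity follows from the deviations at one level to \<open>1\<close> and to \<open>0\<close>; for sufficiency the payoffs are
  compared term by term.
\<close>

lemma equilibrium_iff:
  assumes s: "s \<in> strategies"
  shows "equilibrium M s \<longleftrightarrow>
    (\<forall>n. (0 < net_flow s n \<longrightarrow> s n = 1) \<and> (net_flow s n < 0 \<longrightarrow> s n = 0))"
proof -
  note rate_pos = arrival_rate_pos[OF s]
  have s01: "0 \<le> s n" "s n \<le> 1" for n using s by (auto simp: strategies_def)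
  show ?thesis
  proof
    assume eq: "equilibrium M s"
    have no_gain: "(v - s n) * net_flow s n \<le> 0" if "0 \<le> v" "v \<le> 1" for v n
    proof -
      have "s(n := v) \<in> strategies" using s01 that by (simp add: strategies_def)
      then have "payoff M (s(n := v)) s \<le> payoff M s s" using eq unfolding equilibrium_def by blast
      then have "(v - s n) * net_flow s n / arrival_rate s \<le> 0"
        by (simp add: payoff_change_one[OF s])
      then show ?thesis using rate_pos by (simp add: divide_le_0_iff)
    qed
    show "\<forall>n. (0 < net_flow s n \<longrightarrow> s n = 1) \<and> (net_flow s n < 0 \<longrightarrow> s n = 0)"
    proof (intro allI conjI impI)
      fix n
      show "s n = 1" if "0 < net_flow s n"
        using no_gain[of 1 n] that s01(2)[of n] by (simp add: mult_le_0_iff)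
      show "s n = 0" if "net_flow s n < 0"
      proof (rule ccontr)
        assume "s n \<noteq> 0"
        then have "s n * net_flow s n < 0" using s01(1)[of n] that by (intro mult_pos_neg) auto
        then show False using no_gain[of 0 n] by simp
      qed
    qed
  next
    assume best: "\<forall>n. (0 < net_flow s n \<longrightarrow> s n = 1) \<and> (net_flow s n < 0 \<longrightarrow> s n = 0)"
    have "payoff M s' s \<le> payoff M s s" if s': "s' \<in> strategies" for s'
      unfolding payoff_terms[OF s]
    proof (rule infsum_mono[OF payoff_summable[OF s'] payoff_summable[OF s]])
      fix n
      have s'01: "0 \<le> s' n" "s' n \<le> 1" for n using s' by (auto simp: strategies_def)
      have "s' n * net_flow s n \<le> s n * net_flow s n"
      proof (cases "net_flow s n" "0 :: real" rule: linorder_cases)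
        case less
        then have "s n = 0" using best by blast
        moreover have "s' n * net_flow s n \<le> 0"
          using s'01[of n] less by (simp add: mult_nonneg_nonpos)
        ultimately show ?thesis by simp
      next
        case greater
        then have "s n = 1" using best by blast
        then show ?thesis using s'01[of n] greater by simp
      qed simp
      then show "s' n * net_flow s n / arrival_rate s \<le> s n * net_flow s n / arrival_rate s"
        using rate_pos by (simp add: divide_right_mono)
    qed
    then show "equilibrium M s" using s by (simp add: equilibrium_def)
  qed
qed

section \<open>The geometric rates of the always-join chain\<close>

text \<open>
  Inserting \<open>p(n,e) = v\<^sub>e c\<^sup>n\<close> into the always-join recursion gives a homogeneous pair for \<open>v\<close>. With
  \<open>z = 1 - 1/c\<close> its determinant is the following polynomial.
\<close>

abbreviation charpoly :: "real \<Rightarrow> real" where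
  "charpoly z \<equiv> arr M E1 * arr M E2 * z\<^sup>2
     + (arr M E1 * (vis M E2 + sw M E2) + arr M E2 * (vis M E1 + sw M E1)) * z + K M"

lemma K_pos: "0 < K M"
  by (simp add: K_def add_pos_pos)

lemma Delta_eq_discriminant:
  "Delta M = (arr M E1 * (vis M E2 + sw M E2) + arr M E2 * (vis M E1 + sw M E1))\<^sup>2
     - 4 * (arr M E1 * arr M E2) * K M"
  unfolding Delta_def K_def by (simp add: power2_eq_square algebra_simps)

lemma Delta_pos: "0 < Delta M"
  unfolding Delta_def by (intro add_nonneg_pos) auto

lemma sqrt_Delta_pos: "0 < sqrt (Delta M)"
  using Delta_pos by simp

lemma charpoly_z1: "charpoly (z1 M) = 0" and charpoly_z2: "charpoly (z2 M) = 0"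
proof -
  define l where "l = arr M E1 * arr M E2"
  define m where "m = arr M E1 * (vis M E2 + sw M E2) + arr M E2 * (vis M E1 + sw M E1)"
  have l: "l > 0" by (simp add: l_def)
  have root: "l * z\<^sup>2 + m * z + K M = 0"
    if z: "z = (- m + r) / (2 * l)" and r: "r\<^sup>2 = Delta M" for z r
  proof -
    have lin: "2 * l * z + m = r" using l by (simp add: z field_simps)
    have "4 * l * (l * z\<^sup>2 + m * z + K M) = (2 * l * z + m)\<^sup>2 - (m\<^sup>2 - 4 * l * K M)"
      by (simp add: power2_eq_square algebra_simps)
    also have "\<dots> = 0" unfolding lin r unfolding Delta_eq_discriminant l_def m_def by simp
    finally show ?thesis using l by simp
  qed
  have sq: "(sqrt (Delta M))\<^sup>2 = Delta M" "(- sqrt (Delta M))\<^sup>2 = Delta M"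
    using Delta_pos by simp_all
  show "charpoly (z1 M) = 0" "charpoly (z2 M) = 0"
    using root[OF _ sq(1), of "z1 M"] root[OF _ sq(2), of "z2 M"]
    unfolding z1_def z2_def l_def m_def by (simp_all add: mult.assoc)
qed

lemma z1_minus_z2: "arr M E1 * arr M E2 * (z1 M - z2 M) = sqrt (Delta M)"
  unfolding z1_def z2_def by (simp add: field_simps)

lemma z2_less_z1: "z2 M < z1 M"
proof -
  have "0 < (arr M E1 * arr M E2) * (z1 M - z2 M)" using z1_minus_z2 sqrt_Delta_pos by simp
  then have "0 < z1 M - z2 M" by (rule zero_less_mult_pos) simp
  then show ?thesis by simp
qed

lemma z1_neg: "z1 M < 0"
proof (rule ccontr)
  assume "\<not> z1 M < 0"
  then have "0 < charpoly (z1 M)" using K_pos by (intro add_nonneg_pos add_nonneg_nonneg) auto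
  then show False using charpoly_z1 by simp
qed

definition decay1 :: real where "decay1 = 1 / (1 - z1 M)"
definition decay2 :: real where "decay2 = 1 / (1 - z2 M)"

lemma decay: "0 < decay2" "decay2 < decay1" "decay1 < 1"
  using z1_neg z2_less_z1 unfolding decay1_def decay2_def
  by (auto intro!: divide_strict_left_mono mult_pos_pos simp: field_simps)

text \<open>
  The numerators of \<open>A\<^sub>e\<close> and \<open>B\<^sub>e\<close>, which are the components of an eigenvector for a root \<open>z\<close>.
\<close>

definition numer :: "env \<Rightarrow> real \<Rightarrow> real" where
  "numer e z = (vis M e * arr M (other e) * z + K M) * p_E M e"

lemma coef_A_numer: "coef_A M e = numer e (z1 M) / (sqrt (Delta M) * (1 - z1 M))"
  and coef_B_numer: "coef_B M e = - (numer e (z2 M) / (sqrt (Delta M) * (1 - z2 M)))"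
  by (simp_all add: coef_A_def coef_B_def numer_def)

lemma numer_eigen:
  assumes "charpoly z = 0"
  shows "(arr M e * z + vis M e + sw M e) * numer e z = sw M (other e) * numer (other e) z"
proof -
  define D where "D = sw M E1 + sw M E2"
  have D: "D \<noteq> 0" unfolding D_def using sw_pos[of E1] sw_pos[of E2] by linarith
  have "(arr M e * z + vis M e + sw M e) * (vis M e * arr M (other e) * z + K M)
      - sw M e * (vis M (other e) * arr M e * z + K M) = vis M e * charpoly z"
    by (cases e) (simp_all add: K_def power2_eq_square algebra_simps)
  then have eq: "(arr M e * z + vis M e + sw M e) * (vis M e * arr M (other e) * z + K M)
      = sw M e * (vis M (other e) * arr M e * z + K M)"
    using assms by simp
  have "(arr M e * z + vis M e + sw M e) * numer e z
      = (arr M e * z + vis M e + sw M e) * (vis M e * arr M (other e) * z + K M) * sw M (other e) / D"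
    by (simp add: numer_def p_E_def D_def)
  also have "\<dots> = sw M (other e) * numer (other e) z"
    unfolding eq by (simp add: numer_def p_E_def D_def)
  finally show ?thesis .
qed

lemma coef_A_eigen:
  "(arr M e * z1 M + vis M e + sw M e) * coef_A M e = sw M (other e) * coef_A M (other e)"
  unfolding coef_A_numer using numer_eigen[OF charpoly_z1, of e] by (simp add: times_divide_eq_right)

lemma coef_B_eigen:
  "(arr M e * z2 M + vis M e + sw M e) * coef_B M e = sw M (other e) * coef_B M (other e)"
  unfolding coef_B_numer using numer_eigen[OF charpoly_z2, of e] by (simp add: times_divide_eq_right)

text \<open>
  The two eigenvectors are scaled so that the sum satisfies the equation at level \<open>0\<close>. The difference of
  the numerators is linear in \<open>z\<close>, and \<open>\<lambda>\<^sub>1\<lambda>\<^sub>2(z\<^sub>1 - z\<^sub>2)\<close> is the square root of the discriminant.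
\<close>

lemma coef_boundary:
  "arr M e * ((1 - z1 M) * coef_A M e + (1 - z2 M) * coef_B M e) = vis M e * p_E M e"
proof -
  have "1 - z1 M \<noteq> 0" "1 - z2 M \<noteq> 0" using z1_neg z2_less_z1 by auto
  then have "(1 - z1 M) * coef_A M e + (1 - z2 M) * coef_B M e
      = (numer e (z1 M) - numer e (z2 M)) / sqrt (Delta M)"
    unfolding coef_A_numer coef_B_numer by (simp add: diff_divide_distrib)
  also have "arr M e * \<dots> = vis M e * p_E M e * (arr M e * arr M (other e) * (z1 M - z2 M)) / sqrt (Delta M)"
    by (simp add: numer_def algebra_simps)
  also have "arr M e * arr M (other e) = arr M E1 * arr M E2"
    by (cases e) simp_all
  finally show ?thesis using sqrt_Delta_pos by (simp add: z1_minus_z2)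
qed

section \<open>Stationary distributions under threshold strategies\<close>

text \<open>
  In closed form, the sum over \<open>i \<ge> n\<close> of \<open>x^(i - n)\<close> times the always-join mass \<open>A\<^sub>e a\<^sup>i + B\<^sub>e b\<^sup>i\<close>, where \<open>x\<close> is the
  probability that a customer balks. So \<open>x = 0\<close> gives the mass of level \<open>n\<close> itself and \<open>x = 1\<close> that of all
  levels from \<open>n\<close> on.
\<close>

definition thinned_tail :: "real \<Rightarrow> nat \<Rightarrow> env \<Rightarrow> real" where
  "thinned_tail x n e = coef_A M e * decay1 ^ n / (1 - x * decay1)
                      + coef_B M e * decay2 ^ n / (1 - x * decay2)"

lemma thinned_denominators:
  assumes "x \<le> 1"
  shows "0 < 1 - x * decay1" "0 < 1 - x * decay2"
proof -
  have "x * decay1 \<le> decay1" "x * decay2 \<le> decay2"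
    using assms decay by (simp_all add: mult_left_le_one_le mult_right_le_one_le)
  then show "0 < 1 - x * decay1" "0 < 1 - x * decay2" using decay by linarith+
qed

text \<open>
  A level that is left with probability \<open>1 - x\<close> per arrival and fed as in the always-join chain carries the
  thinned tail. The eigenvector equations turn the left side into
  \<open>\<lambda>\<^sub>e (1 - z - x)\<close> times each component, and \<open>1 - x a = a (1 - z\<^sub>1 - x)\<close> cancels the denominator; what
  remains is the always-join mass one level below, or the boundary equation at level \<open>0\<close>.
\<close>

lemma thinned_tail_balance:
  assumes "x \<le> 1"
  shows "(arr M e * (1 - x) + vis M e + sw M e) * thinned_tail x n e
      - sw M (other e) * thinned_tail x n (other e) = inflow (p_E M) (\<lambda>_. 1) (thinned_tail 0) n e"
proof -
  have z: "1 - z1 M \<noteq> 0" "1 - z2 M \<noteq> 0" using z1_neg z2_less_z1 by auto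
  define a where "a = decay1 ^ n / (1 - x * decay1)"
  define b where "b = decay2 ^ n / (1 - x * decay2)"
  have tail: "thinned_tail x n e = coef_A M e * a + coef_B M e * b" for e
    by (simp add: thinned_tail_def a_def b_def)
  have a: "a * (1 - z1 M - x) = decay1 ^ n * (1 - z1 M)"
    and b: "b * (1 - z2 M - x) = decay2 ^ n * (1 - z2 M)"
  proof -
    have "1 - x * decay1 = (1 - z1 M - x) / (1 - z1 M)" "1 - x * decay2 = (1 - z2 M - x) / (1 - z2 M)"
      using z unfolding decay1_def decay2_def by (simp_all add: diff_divide_distrib)
    moreover from this have "1 - z1 M - x \<noteq> 0" "1 - z2 M - x \<noteq> 0"
      using thinned_denominators[OF assms] by auto
    ultimately show "a * (1 - z1 M - x) = decay1 ^ n * (1 - z1 M)" "b * (1 - z2 M - x) = decay2 ^ n * (1 - z2 M)"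
      by (simp_all add: a_def b_def)
  qed
  have "(arr M e * (1 - x) + vis M e + sw M e) * thinned_tail x n e - sw M (other e) * thinned_tail x n (other e)
      = a * ((arr M e * (1 - x) + vis M e + sw M e) * coef_A M e - sw M (other e) * coef_A M (other e))
      + b * ((arr M e * (1 - x) + vis M e + sw M e) * coef_B M e - sw M (other e) * coef_B M (other e))"
    unfolding tail by (simp add: algebra_simps)
  also have "\<dots> = arr M e * (coef_A M e * (a * (1 - z1 M - x)) + coef_B M e * (b * (1 - z2 M - x)))"
    unfolding coef_A_eigen[symmetric] coef_B_eigen[symmetric] by (simp add: algebra_simps)
  also have "\<dots> = arr M e * (coef_A M e * (decay1 ^ n * (1 - z1 M)) + coef_B M e * (decay2 ^ n * (1 - z2 M)))"
    unfolding a b ..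
  also have "\<dots> = inflow (p_E M) (\<lambda>_. 1) (thinned_tail 0) n e"
  proof (cases n)
    case 0
    then show ?thesis using coef_boundary[of e] by (simp add: algebra_simps)
  next
    case (Suc k)
    have shift: "c ^ n * (1 - z) = c ^ k" if "c * (1 - z) = 1" for c z :: real
    proof -
      have "c ^ n * (1 - z) = (c * (1 - z)) * c ^ k" by (simp add: Suc)
      then show ?thesis unfolding that by simp
    qed
    have shift1: "decay1 ^ n * (1 - z1 M) = decay1 ^ k"
      by (rule shift) (use z in \<open>simp add: decay1_def\<close>)
    have shift2: "decay2 ^ n * (1 - z2 M) = decay2 ^ k"
      by (rule shift) (use z in \<open>simp add: decay2_def\<close>)
    show ?thesis unfolding shift1 shift2 by (simp add: Suc thinned_tail_def)
  qed
  finally show ?thesis .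
qed

lemma always_join_strategy: "(\<lambda>_. 1) \<in> strategies"
  by (simp add: strategies_def)

lemma threshold_strategy: "0 \<le> \<theta> \<Longrightarrow> \<theta> \<le> 1 \<Longrightarrow> threshold n\<^sub>0 \<theta> \<in> strategies"
  by (simp add: strategies_def threshold_def)

lemma always_join_balanced: "balanced (p_E M) (\<lambda>_. 1) (thinned_tail 0)"
  unfolding balanced_def using thinned_tail_balance[of 0] by simp

lemma thinned_tail_pos: "0 < thinned_tail 0 n e"
  by (rule balanced_pos[OF always_join_strategy always_join_balanced]) simp

text \<open>
  Level \<open>n\<^sub>0 + 1\<close> carries what the levels from \<open>n\<^sub>0\<close> on would carry together, minus what is held back at \<open>n\<^sub>0\<close>.
  Its equation is the difference of the thinned balance equations for \<open>x = 1\<close> and \<open>x = 1 - \<theta>\<close>, which have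
  the same right-hand side.
\<close>

lemma threshold_balanced:
  assumes \<theta>: "0 \<le> \<theta>" "\<theta> \<le> 1"
  shows "balanced (p_E M) (threshold n\<^sub>0 \<theta>)
    (\<lambda>n e. if n < n\<^sub>0 then thinned_tail 0 n e
           else if n = n\<^sub>0 then thinned_tail (1 - \<theta>) n\<^sub>0 e
           else if n = Suc n\<^sub>0 then thinned_tail 1 n\<^sub>0 e - thinned_tail (1 - \<theta>) n\<^sub>0 e
           else 0)" (is "balanced _ _ ?p")
  unfolding balanced_def
proof (intro allI)
  fix n e
  have inflow: "inflow (p_E M) (threshold n\<^sub>0 \<theta>) ?p n e = inflow (p_E M) (\<lambda>_. 1) (thinned_tail 0) n e"
    if "n \<le> n\<^sub>0"
    using that by (cases n) (simp_all add: threshold_def)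
  consider "n < n\<^sub>0" | "n = n\<^sub>0" | "n = Suc n\<^sub>0" | "Suc n\<^sub>0 < n" by linarith
  then show "exit_rate (threshold n\<^sub>0 \<theta>) n e * ?p n e - sw M (other e) * ?p n (other e)
      = inflow (p_E M) (threshold n\<^sub>0 \<theta>) ?p n e"
  proof cases
    case 1
    then show ?thesis
      using thinned_tail_balance[of 0 e n] by (subst inflow) (simp_all add: threshold_def)
  next
    case 2
    then show ?thesis
      using thinned_tail_balance[of "1 - \<theta>" e n] \<theta> by (subst inflow) (simp_all add: threshold_def)
  next
    case 3
    have "(vis M e + sw M e) * thinned_tail 1 n\<^sub>0 e - sw M (other e) * thinned_tail 1 n\<^sub>0 (other e)
        = (arr M e * \<theta> + vis M e + sw M e) * thinned_tail (1 - \<theta>) n\<^sub>0 e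
          - sw M (other e) * thinned_tail (1 - \<theta>) n\<^sub>0 (other e)"
      using thinned_tail_balance[of 1 e n\<^sub>0] thinned_tail_balance[of "1 - \<theta>" e n\<^sub>0] \<theta> by simp
    with 3 show ?thesis by (simp add: threshold_def algebra_simps)
  next
    case 4
    then obtain k where "n = Suc k" "n\<^sub>0 < k" by (cases n) auto
    then show ?thesis by (simp add: threshold_def)
  qed
qed


section \<open>The benefit flow found by an arriving customer\<close>

definition weight1 :: real where "weight1 = reward M * tot_D M - cost M * tot_A M"
definition weight2 :: real where "weight2 = reward M * tot_E M - cost M * tot_B M"

text \<open>
  The analogue of \<open>thinned_tail\<close> for the weighted benefit; it equals \<open>F M n (1 - x)\<close>.
\<close>

definition thinned_benefit :: "real \<Rightarrow> nat \<Rightarrow> real" where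
  "thinned_benefit x n = weight1 * decay1 ^ n / (1 - x * decay1) + weight2 * decay2 ^ n / (1 - x * decay2)"

abbreviation benefit :: "nat \<Rightarrow> real" where
  "benefit \<equiv> thinned_benefit 0"

lemma thinned_benefit_eq:
  "thinned_benefit x n = (reward M - cost M * T M E1) * (arr M E1 * thinned_tail x n E1)
                       + (reward M - cost M * T M E2) * (arr M E2 * thinned_tail x n E2)"
proof -
  define a where "a = decay1 ^ n / (1 - x * decay1)"
  define b where "b = decay2 ^ n / (1 - x * decay2)"
  have "thinned_tail x n e = coef_A M e * a + coef_B M e * b" for e
    by (simp add: thinned_tail_def a_def b_def)
  moreover have "thinned_benefit x n = weight1 * a + weight2 * b"
    by (simp add: thinned_benefit_def a_def b_def)
  ultimately show ?thesis
    by (simp add: weight1_def weight2_def tot_A_def tot_B_def tot_D_def tot_E_def algebra_simps)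
qed

lemma net_flow_always_join: "net_flow (\<lambda>_. 1) n = benefit n"
  by (simp add: net_flow_def arr_flow_def thinned_benefit_eq
      p_ao_eqI[OF always_join_strategy always_join_balanced])

lemma net_flow_threshold:
  assumes "0 \<le> \<theta>" "\<theta> \<le> 1"
  shows "net_flow (threshold n\<^sub>0 \<theta>) n =
    (if n < n\<^sub>0 then benefit n
     else if n = n\<^sub>0 then thinned_benefit (1 - \<theta>) n\<^sub>0
     else if n = Suc n\<^sub>0 then thinned_benefit 1 n\<^sub>0 - thinned_benefit (1 - \<theta>) n\<^sub>0
     else 0)"
  by (simp add: net_flow_def arr_flow_def thinned_benefit_eq
      p_ao_eqI[OF threshold_strategy[OF assms] threshold_balanced[OF assms]] right_diff_distrib)

lemma equilibrium_always_join_iff: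
  "equilibrium M (\<lambda>_. 1) \<longleftrightarrow> (\<forall>n. 0 \<le> benefit n)"
  unfolding equilibrium_iff[OF always_join_strategy] net_flow_always_join by (simp add: not_less)

lemma equilibrium_pure_threshold_iff:
  "equilibrium M (threshold n\<^sub>0 0) \<longleftrightarrow> (\<forall>n<n\<^sub>0. 0 \<le> benefit n) \<and> thinned_benefit 1 n\<^sub>0 \<le> 0"
proof -
  have "equilibrium M (threshold n\<^sub>0 0) \<longleftrightarrow>
      (\<forall>n. (n < n\<^sub>0 \<longrightarrow> 0 \<le> benefit n) \<and> (n = n\<^sub>0 \<longrightarrow> thinned_benefit 1 n\<^sub>0 \<le> 0))"
    unfolding equilibrium_iff[OF threshold_strategy[OF order_refl zero_le_one]]
      net_flow_threshold[OF order_refl zero_le_one]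
    by (intro all_cong1) (simp add: threshold_def not_less)
  then show ?thesis by blast
qed

text \<open>
  Indifference at \<open>n\<^sub>0\<close> is required because the strategy randomises there. Since level \<open>n\<^sub>0 + 1\<close> is reached and
  balks, \<open>F(n\<^sub>0,0) - F(n\<^sub>0,\<theta>)\<close> must not be positive, which by indifference is a condition on \<open>F(n\<^sub>0,0)\<close>.
\<close>

lemma equilibrium_mixed_threshold_iff:
  assumes \<theta>: "0 < \<theta>" "\<theta> < 1"
  shows "equilibrium M (threshold n\<^sub>0 \<theta>) \<longleftrightarrow>
    (\<forall>n<n\<^sub>0. 0 \<le> benefit n) \<and> thinned_benefit (1 - \<theta>) n\<^sub>0 = 0 \<and> thinned_benefit 1 n\<^sub>0 \<le> 0"
proof -
  have 01: "0 \<le> \<theta>" "\<theta> \<le> 1" using \<theta> by simp_all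
  have "equilibrium M (threshold n\<^sub>0 \<theta>) \<longleftrightarrow>
      (\<forall>n. (n < n\<^sub>0 \<longrightarrow> 0 \<le> benefit n) \<and> (n = n\<^sub>0 \<longrightarrow> thinned_benefit (1 - \<theta>) n\<^sub>0 = 0)
         \<and> (n = Suc n\<^sub>0 \<longrightarrow> thinned_benefit 1 n\<^sub>0 \<le> thinned_benefit (1 - \<theta>) n\<^sub>0))"
    unfolding equilibrium_iff[OF threshold_strategy[OF 01]] net_flow_threshold[OF 01]
    using \<theta> by (intro all_cong1) (auto simp: threshold_def not_less)
  also have "\<dots> \<longleftrightarrow> (\<forall>n<n\<^sub>0. 0 \<le> benefit n) \<and> thinned_benefit (1 - \<theta>) n\<^sub>0 = 0
      \<and> thinned_benefit 1 n\<^sub>0 \<le> thinned_benefit (1 - \<theta>) n\<^sub>0"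
    by blast
  finally show ?thesis by auto
qed

lemma discounted_two_geometric_sum:
  fixes a b u v x :: real
  assumes x: "0 \<le> x" "x \<le> 1" and a: "0 < a" "a < 1" and b: "0 < b" "b < 1"
  shows "(\<Sum>\<^sub>\<infinity>i\<in>{n..}. x ^ (i - n) * (u * a ^ i + v * b ^ i))
       = u * a ^ n / (1 - x * a) + v * b ^ n / (1 - x * b)"
proof (rule infsumI)
  have geo: "((\<lambda>k. (x * c) ^ k) has_sum (1 / (1 - x * c))) UNIV" if "0 < c" "c < 1" for c
  proof -
    have "x * c \<le> c" using x that by (simp add: mult_left_le_one_le)
    then have "x * c < 1" "0 \<le> x * c" using that x by (linarith, simp)
    then show ?thesis
      by (intro sums_nonneg_imp_has_sum geometric_sums) auto
  qed
  have "((\<lambda>k. u * a ^ n * (x * a) ^ k + v * b ^ n * (x * b) ^ k) has_sum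
      (u * a ^ n * (1 / (1 - x * a)) + v * b ^ n * (1 / (1 - x * b)))) UNIV"
    by (intro has_sum_add has_sum_cmult_right geo a b)
  also have "(\<lambda>k. u * a ^ n * (x * a) ^ k + v * b ^ n * (x * b) ^ k)
      = (\<lambda>k. x ^ (k + n - n) * (u * a ^ (k + n) + v * b ^ (k + n)))"
    by (simp add: fun_eq_iff power_add power_mult_distrib algebra_simps)
  finally show "((\<lambda>i. x ^ (i - n) * (u * a ^ i + v * b ^ i)) has_sum
      (u * a ^ n / (1 - x * a) + v * b ^ n / (1 - x * b))) {n..}"
    by (subst (asm) has_sum_reindex_bij_witness[of _ "\<lambda>i. i - n" "\<lambda>k. k + n" "{n..}"
          "\<lambda>i. x ^ (i - n) * (u * a ^ i + v * b ^ i)"]) auto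
qed

lemma F_eq:
  assumes "0 \<le> \<theta>" "\<theta> \<le> 1"
  shows "F M n \<theta> = thinned_benefit (1 - \<theta>) n"
  unfolding F_def thinned_benefit_def decay1_def[symmetric] decay2_def[symmetric]
    weight1_def[symmetric] weight2_def[symmetric]
  by (rule discounted_two_geometric_sum) (use assms decay in auto)

definition arrival_flow :: "nat \<Rightarrow> real" where
  "arrival_flow n = tot_D M * decay1 ^ n + tot_E M * decay2 ^ n"

lemma H_U_eq: "H_U M n = benefit n / arrival_flow n"
proof -
  have "G M n 1 = arrival_flow n"
    unfolding G_def arrival_flow_def decay1_def[symmetric] decay2_def[symmetric]
    \<comment> \<open>By the convention \<open>0\<^sup>0 = 1\<close> only the term with \<open>i = n\<close> survives.\<close>
    using discounted_two_geometric_sum[of 0 decay1 decay2 n "tot_D M" "tot_E M"] decay by simp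
  then show ?thesis by (simp add: H_U_def F_eq)
qed

lemma arrival_flow_pos: "0 < arrival_flow n"
proof -
  have "arrival_flow n = arr M E1 * thinned_tail 0 n E1 + arr M E2 * thinned_tail 0 n E2"
    by (simp add: arrival_flow_def tot_D_def tot_E_def thinned_tail_def algebra_simps)
  also have "\<dots> > 0" by (simp add: add_pos_pos thinned_tail_pos)
  finally show ?thesis .
qed

text \<open>
  Divided by \<open>a\<^sup>n\<close>, the positive always-join masses tend to \<open>A\<^sub>e\<close>.
\<close>

lemma coef_A_nonneg: "0 \<le> coef_A M e"
proof (rule LIMSEQ_le_const[where X = "\<lambda>n. coef_A M e + coef_B M e * (decay2 / decay1) ^ n"])
  have "(\<lambda>n. (decay2 / decay1) ^ n) \<longlonglongrightarrow> 0"
    using decay by (intro LIMSEQ_realpow_zero) auto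
  then show "(\<lambda>n. coef_A M e + coef_B M e * (decay2 / decay1) ^ n) \<longlonglongrightarrow> coef_A M e"
    using tendsto_add[OF tendsto_const tendsto_mult_right_zero] by fastforce
  have "0 \<le> coef_A M e + coef_B M e * (decay2 / decay1) ^ n" for n
  proof -
    have "0 < thinned_tail 0 n e / decay1 ^ n" using thinned_tail_pos decay by simp
    also have "\<dots> = coef_A M e + coef_B M e * (decay2 / decay1) ^ n"
      using decay by (simp add: thinned_tail_def power_divide field_simps)
    finally show ?thesis by simp
  qed
  then show "\<exists>N. \<forall>n\<ge>N. 0 \<le> coef_A M e + coef_B M e * (decay2 / decay1) ^ n" by blast
qed

lemma T_diff: "T M E1 - T M E2 = (vis M E2 - vis M E1) / K M"
  by (simp add: T_def flip: diff_divide_distrib)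

text \<open>
  The determinant \<open>(R E - C B) D - (R D - C A) E = C (A E - B D)\<close>, whose sign decides whether the ratio
  \<open>F(n,1)/G(n,1)\<close> decreases or increases in \<open>n\<close>.
\<close>

definition crowding :: real where
  "crowding = weight2 * tot_D M - weight1 * tot_E M"

end

section \<open>Single crossing when customers avoid the crowd\<close>

locale avoid_the_crowd = clearing +
  assumes opposite: "(vis M E1 - vis M E2) * (rho M E1 - rho M E2) < 0"
begin

lemma opposite_rates: "(vis M E1 - vis M E2) * (arr M E1 * vis M E2 - arr M E2 * vis M E1) < 0"
proof -
  have "arr M E1 * vis M E2 - arr M E2 * vis M E1 = (rho M E1 - rho M E2) * (vis M E1 * vis M E2)"
    by (simp add: rho_def field_simps)
  then have "(vis M E1 - vis M E2) * (arr M E1 * vis M E2 - arr M E2 * vis M E1)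
      = ((vis M E1 - vis M E2) * (rho M E1 - rho M E2)) * (vis M E1 * vis M E2)"
    by simp
  also have "\<dots> < 0" by (rule mult_neg_pos[OF opposite]) simp
  finally show ?thesis .
qed

text \<open>
  The determinant factors as \<open>\<lambda>\<^sub>1\<lambda>\<^sub>2 (T\<^sub>1 - T\<^sub>2)(A\<^sub>1B\<^sub>2 - A\<^sub>2B\<^sub>1)\<close>. The first difference is a positive multiple of
  \<open>\<mu>\<^sub>2 - \<mu>\<^sub>1\<close>; the second is a positive multiple of \<open>\<lambda>\<^sub>1\<mu>\<^sub>2 - \<lambda>\<^sub>2\<mu>\<^sub>1\<close>, that is of \<open>\<rho>\<^sub>1 - \<rho>\<^sub>2\<close>. The assumption says that
  \<open>\<mu>\<^sub>1 - \<mu>\<^sub>2\<close> and \<open>\<rho>\<^sub>1 - \<rho>\<^sub>2\<close> have opposite signs.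
\<close>

lemma crowding_pos: "0 < crowding"
proof -
  define c1 where "c1 = 1 / (sqrt (Delta M) * (1 - z1 M))"
  define c2 where "c2 = 1 / (sqrt (Delta M) * (1 - z2 M))"
  have c: "c1 > 0" "c2 > 0"
    using sqrt_Delta_pos z1_neg z2_less_z1 by (simp_all add: c1_def c2_def)
  have A: "coef_A M e = c1 * numer e (z1 M)" and B: "coef_B M e = - (c2 * numer e (z2 M))" for e
    by (simp_all add: coef_A_numer coef_B_numer c1_def c2_def)
  have det: "coef_A M E1 * coef_B M E2 - coef_A M E2 * coef_B M E1
      = c1 * c2 * (numer E2 (z1 M) * numer E1 (z2 M) - numer E1 (z1 M) * numer E2 (z2 M))"
    unfolding A B by (simp add: algebra_simps)
  have num: "numer E2 (z1 M) * numer E1 (z2 M) - numer E1 (z1 M) * numer E2 (z2 M)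
      = p_E M E1 * p_E M E2 * K M * (z1 M - z2 M) * (arr M E1 * vis M E2 - arr M E2 * vis M E1)"
    by (simp add: numer_def algebra_simps)
  have "crowding = cost M * (tot_A M * tot_E M - tot_B M * tot_D M)"
    by (simp add: crowding_def weight1_def weight2_def algebra_simps)
  also have "tot_A M * tot_E M - tot_B M * tot_D M
      = arr M E1 * arr M E2 * (T M E1 - T M E2) * (coef_A M E1 * coef_B M E2 - coef_A M E2 * coef_B M E1)"
    by (simp add: tot_A_def tot_B_def tot_D_def tot_E_def algebra_simps)
  also have "\<dots> = (arr M E1 * arr M E2 * c1 * c2 * p_E M E1 * p_E M E2 * (z1 M - z2 M))
      * - ((vis M E1 - vis M E2) * (arr M E1 * vis M E2 - arr M E2 * vis M E1))"
    unfolding T_diff det num using K_pos by (simp add: field_simps)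
  finally show ?thesis
    using c opposite_rates z2_less_z1 cost_pos by (simp only:) (intro mult_pos_pos, simp_all)
qed

text \<open>
  Both \<open>A\<^sub>e\<close> are nonnegative; if both vanished, so would the determinant.
\<close>

lemma tot_D_pos: "0 < tot_D M"
proof (rule ccontr)
  assume "\<not> 0 < tot_D M"
  moreover have nonneg: "0 \<le> arr M e * coef_A M e" for e by (simp add: coef_A_nonneg)
  ultimately have "arr M E1 * coef_A M E1 = 0" "arr M E2 * coef_A M E2 = 0"
    using nonneg[of E1] nonneg[of E2] unfolding tot_D_def by linarith+
  then have "tot_A M = 0" "tot_D M = 0" by (simp_all add: tot_A_def tot_D_def)
  then have "crowding = 0" by (simp add: crowding_def weight1_def)
  with crowding_pos show False by simp
qed

text \<open>
  The cross difference of the ratios \<open>F(m,1)/G(m,1)\<close> and \<open>F(n,1)/G(n,1)\<close> is the determinant times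
  \<open>b\<^sup>m a\<^sup>n - a\<^sup>m b\<^sup>n\<close>, which is negative for \<open>n < m\<close> because \<open>b < a\<close>. So the ratio decreases strictly.
\<close>

lemma benefit_single_crossing:
  assumes "n < m" and "benefit n \<le> 0"
  shows "benefit m < 0"
proof -
  have "benefit m * arrival_flow n - benefit n * arrival_flow m
      = crowding * (decay2 ^ m * decay1 ^ n - decay1 ^ m * decay2 ^ n)"
    by (simp add: thinned_benefit_def arrival_flow_def crowding_def algebra_simps)
  moreover obtain k where k: "m = n + Suc k" using \<open>n < m\<close> less_iff_Suc_add by auto
  have "decay2 ^ Suc k < decay1 ^ Suc k" using decay by (intro power_strict_mono) auto
  then have "decay2 ^ m * decay1 ^ n < decay1 ^ m * decay2 ^ n"
    using decay by (simp add: k power_add)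
  then have "crowding * (decay2 ^ m * decay1 ^ n - decay1 ^ m * decay2 ^ n) < 0"
    using crowding_pos by (simp add: mult_pos_neg)
  ultimately have "benefit m * arrival_flow n < benefit n * arrival_flow m" by simp
  also have "\<dots> \<le> 0" using assms(2) arrival_flow_pos[of m] by (simp add: mult_nonpos_nonneg)
  finally show ?thesis using arrival_flow_pos[of n] by (simp add: mult_less_0_iff)
qed

text \<open>
  The decreasing ratio stays strictly above its limit \<open>weight1 / tot_D M\<close>.
\<close>

lemma benefit_above_limit: "weight1 * arrival_flow n < benefit n * tot_D M"
proof -
  have "benefit n * tot_D M - weight1 * arrival_flow n = crowding * decay2 ^ n"
    by (simp add: thinned_benefit_def arrival_flow_def crowding_def algebra_simps)
  moreover have "0 < crowding * decay2 ^ n" using crowding_pos decay by simp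
  ultimately show ?thesis by simp
qed

lemma benefit_pos_if_weight1_nonneg:
  assumes "0 \<le> weight1"
  shows "0 < benefit n"
proof -
  have "0 \<le> weight1 * arrival_flow n" using assms arrival_flow_pos[of n] by simp
  also note benefit_above_limit
  finally show ?thesis using tot_D_pos by (simp add: zero_less_mult_iff)
qed

lemma H_U_tendsto: "H_U M \<longlonglongrightarrow> weight1 / tot_D M"
proof -
  define t where "t n = (decay2 / decay1) ^ n" for n
  have "t \<longlonglongrightarrow> 0"
    unfolding t_def using decay by (intro LIMSEQ_realpow_zero) auto
  then have "(\<lambda>n. (weight1 + weight2 * t n) / (tot_D M + tot_E M * t n))
      \<longlonglongrightarrow> (weight1 + weight2 * 0) / (tot_D M + tot_E M * 0)"
    using tot_D_pos by (intro tendsto_intros) auto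
  moreover have "H_U M n = (weight1 + weight2 * t n) / (tot_D M + tot_E M * t n)" for n
  proof -
    have "weight1 + weight2 * t n = benefit n / decay1 ^ n"
      "tot_D M + tot_E M * t n = arrival_flow n / decay1 ^ n"
      using decay by (simp_all add: t_def thinned_benefit_def arrival_flow_def power_divide field_simps)
    then show ?thesis using decay by (simp add: H_U_eq)
  qed
  then have "H_U M = (\<lambda>n. (weight1 + weight2 * t n) / (tot_D M + tot_E M * t n))"
    by (rule ext)
  ultimately show ?thesis by simp
qed

lemma lim_H_U: "lim (H_U M) = weight1 / tot_D M"
  by (rule limI[OF H_U_tendsto])

lemma H_U_neg_iff: "H_U M n < 0 \<longleftrightarrow> benefit n < 0"
  using arrival_flow_pos[of n] by (simp add: H_U_eq divide_less_0_iff)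

lemma eventually_benefit_neg:
  assumes "lim (H_U M) < 0"
  shows "\<exists>n. benefit n < 0"
proof -
  have "\<forall>\<^sub>F n in sequentially. H_U M n < 0"
    using H_U_tendsto assms unfolding lim_H_U by (rule order_tendstoD)
  then show ?thesis unfolding H_U_neg_iff by (auto dest: eventually_happens)
qed

text \<open>
  With \<open>x = 1 - \<theta>\<close>, multiplying \<open>F(n,\<theta>)\<close> by the positive number \<open>(1 - x a)(1 - x b)\<close> gives
  \<open>F(n,1) - x * slope n\<close>. So the sign of \<open>F(n,\<theta>)\<close> can be read off an affine function of \<open>x\<close>.
\<close>

definition slope :: "nat \<Rightarrow> real" where
  "slope n = weight1 * decay1 ^ n * decay2 + weight2 * decay2 ^ n * decay1"

lemma thinned_benefit_affine:
  assumes "x \<le> 1"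
  shows "thinned_benefit x n * ((1 - x * decay1) * (1 - x * decay2))
       = benefit n - x * slope n"
proof -
  have "u / d * (d * d') = u * d'" "u / d' * (d * d') = u * d" if "d \<noteq> 0" "d' \<noteq> 0" for u d d' :: real
    using that by simp_all
  then have "thinned_benefit x n * ((1 - x * decay1) * (1 - x * decay2))
      = weight1 * decay1 ^ n * (1 - x * decay2) + weight2 * decay2 ^ n * (1 - x * decay1)"
    unfolding thinned_benefit_def distrib_right using thinned_denominators[OF assms] by auto
  then show ?thesis by (simp add: thinned_benefit_def slope_def algebra_simps)
qed

text \<open>
  This decomposition carries the sign of \<open>F(n,1)\<close> over to all \<open>F(n,\<theta>)\<close> when it agrees with the sign of
  \<open>weight1\<close>, which decides the benefit in a very large crowd.
\<close>

lemma benefit_minus_slope: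
  "benefit n - x * slope n
     = benefit n * (1 - x * decay1) + x * (weight1 * decay1 ^ n * (decay1 - decay2))"
  by (simp add: slope_def thinned_benefit_def algebra_simps)

lemma thinned_benefit_sign:
  assumes "x \<le> 1"
  shows "thinned_benefit x n < 0 \<longleftrightarrow> benefit n < x * slope n"
    and "thinned_benefit x n \<le> 0 \<longleftrightarrow> benefit n \<le> x * slope n"
    and "thinned_benefit x n = 0 \<longleftrightarrow> benefit n = x * slope n"
proof -
  define d where "d = (1 - x * decay1) * (1 - x * decay2)"
  have d: "0 < d" unfolding d_def using thinned_denominators[OF assms] by simp
  have eq: "thinned_benefit x n = (benefit n - x * slope n) / d"
    using thinned_benefit_affine[OF assms, of n] d unfolding d_def[symmetric]
    by (simp add: field_simps)
  show "thinned_benefit x n < 0 \<longleftrightarrow> benefit n < x * slope n"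
    and "thinned_benefit x n \<le> 0 \<longleftrightarrow> benefit n \<le> x * slope n"
    and "thinned_benefit x n = 0 \<longleftrightarrow> benefit n = x * slope n"
    unfolding eq using d by (auto simp: divide_less_0_iff divide_le_0_iff)
qed

lemma tail_step: "thinned_benefit 1 n = benefit n + thinned_benefit 1 (Suc n)"
proof -
  have "u * a ^ n / (1 - a) = u * a ^ n + u * a ^ Suc n / (1 - a)" if "a < 1" for u a :: real
    using that by (simp add: field_simps)
  from this[of decay1 weight1] this[of decay2 weight2] show ?thesis
    using decay by (simp add: thinned_benefit_def)
qed

lemma thinned_benefit_neg_if_benefit_nonpos:
  assumes "benefit n \<le> 0" "0 < x" "x \<le> 1"
  shows "thinned_benefit x n < 0"
proof -
  have "weight1 < 0" using benefit_pos_if_weight1_nonneg[of n] assms(1) by linarith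
  then have neg: "x * (weight1 * decay1 ^ n * (decay1 - decay2)) < 0"
    using assms decay by (simp add: mult_neg_pos mult_pos_neg)
  have "benefit n - x * slope n
      < 0"
    unfolding benefit_minus_slope
    using neg thinned_denominators[OF assms(3)] assms(1) by (simp add: add_nonpos_neg mult_nonpos_nonneg)
  then show ?thesis by (simp add: thinned_benefit_sign[OF assms(3)])
qed

lemma thinned_benefit_pos_if_weight1_nonneg:
  assumes "0 \<le> weight1" "0 \<le> x" "x \<le> 1"
  shows "0 < thinned_benefit x n"
proof -
  have "0 < benefit n - x * slope n"
    unfolding benefit_minus_slope
    using benefit_pos_if_weight1_nonneg[OF assms(1)] thinned_denominators[OF assms(3)] assms decay
    by (intro add_pos_nonneg) simp_all
  then show ?thesis using thinned_benefit_sign(2)[OF assms(3), of n] by linarith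
qed

text \<open>
  Passing from \<open>n\<close> to \<open>n + 1\<close> removes the term \<open>F(n,1)\<close> from the tail sum. If this term is nonnegative the
  tail decreases; if it is negative, all later terms are negative too, hence so is their sum.
\<close>

lemma tail_nonpos_mono:
  assumes "thinned_benefit 1 n \<le> 0" "n \<le> m"
  shows "thinned_benefit 1 m \<le> 0"
  using assms(2)
proof (induction m rule: dec_induct)
  case (step m)
  show ?case
  proof (cases "benefit m < 0")
    case True
    then show ?thesis
      using benefit_single_crossing[of m "Suc m"] thinned_benefit_neg_if_benefit_nonpos[of "Suc m" 1] by simp
  next
    case False
    then show ?thesis using step.IH tail_step[of m] by simp
  qed
qed (rule assms(1))

lemma tail_neg_mono:
  assumes "thinned_benefit 1 n < 0" "n \<le> m"
  shows "thinned_benefit 1 m < 0"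
  using assms(2)
proof (induction m rule: dec_induct)
  case (step m)
  show ?case
  proof (cases "benefit m < 0")
    case True
    then show ?thesis
      using benefit_single_crossing[of m "Suc m"] thinned_benefit_neg_if_benefit_nonpos[of "Suc m" 1] by simp
  next
    case False
    then show ?thesis using step.IH tail_step[of m] by simp
  qed
qed (rule assms(1))

section \<open>Classification of the equilibrium thresholds\<close>

lemma Inf_enat_le_iff: "Inf (enat ` S) \<le> enat n \<longleftrightarrow> (\<exists>k\<in>S. k \<le> n)"
proof
  assume le: "Inf (enat ` S) \<le> enat n"
  show "\<exists>k\<in>S. k \<le> n"
  proof (rule ccontr)
    assume none: "\<not> (\<exists>k\<in>S. k \<le> n)"
    have "enat (Suc n) \<le> Inf (enat ` S)"
    proof (rule INF_greatest)
      fix k assume "k \<in> S"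
      with none have "\<not> k \<le> n" by blast
      then show "enat (Suc n) \<le> enat k" by simp
    qed
    also note le
    finally show False by simp
  qed
next
  assume "\<exists>k\<in>S. k \<le> n"
  then obtain k where "k \<in> S" "k \<le> n" by blast
  then show "Inf (enat ` S) \<le> enat n" by (intro INF_lower2[of k]) simp_all
qed

lemma Inf_enat_le_iff_upward_closed:
  assumes "\<And>k n. P k \<Longrightarrow> k \<le> n \<Longrightarrow> P n"
  shows "Inf (enat ` {n. P n}) \<le> enat n \<longleftrightarrow> P n"
  unfolding Inf_enat_le_iff mem_Collect_eq bex_simps using assms[of _ n] by auto

lemma n_L_le_iff: "n_L M \<le> enat n \<longleftrightarrow> thinned_benefit 1 n \<le> 0"
proof -
  have "n_L M = Inf (enat ` {n. thinned_benefit 1 n \<le> 0})"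
    by (simp add: n_L_def F_eq)
  then show ?thesis by (simp only: Inf_enat_le_iff_upward_closed[OF tail_nonpos_mono])
qed

lemma n_L_plus_le_iff: "n_L_plus M \<le> enat n \<longleftrightarrow> thinned_benefit 1 n < 0"
proof -
  have "n_L_plus M = Inf (enat ` {n. thinned_benefit 1 n < 0})"
    by (simp add: n_L_plus_def F_eq)
  then show ?thesis by (simp only: Inf_enat_le_iff_upward_closed[OF tail_neg_mono])
qed

lemma le_n_U_iff: "enat n \<le> n_U M \<longleftrightarrow> (\<forall>k<n. 0 \<le> benefit k)"
proof -
  have "enat n \<le> n_U M \<longleftrightarrow> (\<forall>k. benefit k < 0 \<longrightarrow> n \<le> k)"
    by (simp add: n_U_def le_INF_iff F_eq)
  also have "\<dots> \<longleftrightarrow> (\<forall>k<n. 0 \<le> benefit k)" by (meson not_less)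
  finally show ?thesis .
qed

lemma less_n_U_minus_iff: "enat n < n_U_minus M \<longleftrightarrow> 0 < benefit n"
proof -
  have "n_U_minus M = Inf (enat ` {n. benefit n \<le> 0})"
    by (simp add: n_U_minus_def F_eq)
  moreover have "benefit m \<le> 0" if "benefit k \<le> 0" "k \<le> m" for k m
    using benefit_single_crossing[of k m] that by (cases "k = m") auto
  ultimately have "n_U_minus M \<le> enat n \<longleftrightarrow> benefit n \<le> 0"
    by (simp only: Inf_enat_le_iff_upward_closed)
  then show ?thesis by (simp flip: not_le)
qed

lemma mixed_range_iff: "n \<in> mixed_range M \<longleftrightarrow> 0 < benefit n \<and> thinned_benefit 1 n < 0"
  by (auto simp: mixed_range_def n_L_plus_le_iff less_n_U_minus_iff)

text \<open>
  At \<open>x = 0\<close> the affine function is positive and at \<open>x = 1\<close> it is negative, so the zero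
  \<open>x = benefit n / slope n\<close> lies strictly between.
\<close>

lemma mixed_root_unique:
  assumes "n \<in> mixed_range M"
  shows "\<exists>!\<theta>. 0 < \<theta> \<and> \<theta> < 1 \<and> F M n \<theta> = 0"
proof -
  have pos: "0 < benefit n" and less: "benefit n < slope n"
    using assms thinned_benefit_sign(1)[of 1 n] by (auto simp: mixed_range_iff)
  have root: "F M n \<theta> = 0 \<longleftrightarrow> \<theta> = 1 - benefit n / slope n" if "0 < \<theta>" "\<theta> < 1" for \<theta>
    using that pos less by (auto simp: F_eq thinned_benefit_sign(3) field_simps)
  have "0 < 1 - benefit n / slope n" "1 - benefit n / slope n < 1"
    using pos less by simp_all
  with root show ?thesis by blast
qed

lemma theta_eq_root:
  assumes "n \<in> mixed_range M"
  shows "0 < theta_eq M n" "theta_eq M n < 1" "F M n (theta_eq M n) = 0"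
  using theI'[OF mixed_root_unique[OF assms]] unfolding theta_eq_def by auto

text \<open>
  If \<open>F(n,\<theta>) = 0\<close> with \<open>0 < \<theta> < 1\<close>, then \<open>F(n,1) > 0\<close>, since otherwise \<open>F(n,\<theta>)\<close> would be negative. An affine
  function that is positive at \<open>x = 0\<close> and vanishes at \<open>x = 1 - \<theta>\<close> is negative at \<open>x = 1\<close>, hence \<open>F(n,0) < 0\<close>.
  Conversely, \<open>F(n,1) > 0\<close> forces all earlier benefits to be nonnegative by single crossing.
\<close>

lemma equilibrium_mixed_iff_root:
  assumes \<theta>: "0 < \<theta>" "\<theta> < 1"
  shows "equilibrium M (threshold n \<theta>) \<longleftrightarrow> n \<in> mixed_range M \<and> F M n \<theta> = 0"
proof
  assume "equilibrium M (threshold n \<theta>)"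
  then have zero: "thinned_benefit (1 - \<theta>) n = 0"
    by (simp add: equilibrium_mixed_threshold_iff[OF \<theta>])
  then have pos: "0 < benefit n"
    using thinned_benefit_neg_if_benefit_nonpos[of n "1 - \<theta>"] \<theta> by fastforce
  have eq: "benefit n = (1 - \<theta>) * slope n"
    using zero thinned_benefit_sign(3)[of "1 - \<theta>" n] \<theta> by simp
  with pos have "0 < slope n" using \<theta> by (simp add: zero_less_mult_iff)
  then have "benefit n < slope n" using eq \<theta> by simp
  then show "n \<in> mixed_range M \<and> F M n \<theta> = 0"
    using pos zero \<theta> thinned_benefit_sign(1)[of 1 n] by (simp add: mixed_range_iff F_eq)
next
  assume root: "n \<in> mixed_range M \<and> F M n \<theta> = 0"
  then have "0 < benefit n" "thinned_benefit 1 n < 0" by (auto simp: mixed_range_iff)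
  moreover have "0 \<le> benefit k" if "k < n" for k
    using benefit_single_crossing[OF that] \<open>0 < benefit n\<close> by fastforce
  ultimately show "equilibrium M (threshold n \<theta>)"
    using root \<theta> by (simp add: equilibrium_mixed_threshold_iff F_eq)
qed

lemma equilibrium_pure_iff_range:
  "equilibrium M (threshold n 0) \<longleftrightarrow> n_L M \<le> enat n \<and> enat n \<le> n_U M"
  by (auto simp: equilibrium_pure_threshold_iff n_L_le_iff le_n_U_iff)

lemma threshold_one: "threshold n 1 = threshold (Suc n) 0"
  by (auto simp: threshold_def fun_eq_iff less_Suc_eq)

text \<open>
  Joining surely at \<open>n\<close> is the pure threshold \<open>n + 1\<close>, so the parameter \<open>\<theta> = 1\<close> adds no strategy.
\<close>

lemma threshold_strategies_cases:
  assumes "s \<in> threshold_strategies"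
  obtains n where "s = threshold n 0" | n \<theta> where "0 < \<theta>" "\<theta> < 1" "s = threshold n \<theta>" | "s = (\<lambda>_. 1)"
proof -
  consider n \<theta> where "0 \<le> \<theta>" "\<theta> \<le> 1" "s = threshold n \<theta>" | "s = (\<lambda>_. 1)"
    using assms by (auto simp: threshold_strategies_def pure_threshold_def)
  then show thesis
  proof cases
    case (1 n \<theta>)
    then consider "\<theta> = 0" | "\<theta> = 1" | "0 < \<theta>" "\<theta> < 1" by linarith
    then show thesis using that 1 threshold_one by cases auto
  qed (rule that)
qed

lemma pure_threshold_in: "pure_threshold m \<in> threshold_strategies"
proof (cases m)
  case (enat n)
  then show ?thesis by (force simp: threshold_strategies_def pure_threshold_def)
qed (simp add: threshold_strategies_def)

text \<open>
  Here \<open>F(n,1) < 0\<close> for all \<open>n\<close>, so against a threshold strategy it never pays to join at a level that is seen.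
\<close>

lemma equilibria_if_never_worthwhile:
  assumes "H_U M 0 < 0"
  shows "{s \<in> threshold_strategies. equilibrium M s} = {pure_threshold 0}"
proof (intro equalityI subsetI)
  have neg: "benefit n < 0" for n
    using assms benefit_single_crossing[of 0 n] by (cases n) (auto simp: H_U_neg_iff)
  fix s
  {
    assume "s \<in> {s \<in> threshold_strategies. equilibrium M s}"
    then have s: "s \<in> threshold_strategies" and eq: "equilibrium M s" by auto
    from s show "s \<in> {pure_threshold 0}"
    proof (cases rule: threshold_strategies_cases)
      case (1 n)
      then have "n = 0" using eq neg[of 0] by (auto simp: equilibrium_pure_threshold_iff)
      then show ?thesis using 1 by (simp add: pure_threshold_def zero_enat_def)
    next
      case (2 n \<theta>)
      then show ?thesis using eq neg[of n] by (simp add: equilibrium_mixed_iff_root mixed_range_iff)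
    next
      case 3
      then have "0 \<le> benefit 0" using eq by (simp add: equilibrium_always_join_iff)
      then show ?thesis using neg[of 0] by simp
    qed
  next
    assume "s \<in> {pure_threshold 0}"
    moreover have "equilibrium M (threshold 0 0)"
      using thinned_benefit_neg_if_benefit_nonpos[of 0 1] neg[of 0]
      by (simp add: equilibrium_pure_threshold_iff)
    ultimately show "s \<in> {s \<in> threshold_strategies. equilibrium M s}"
      using pure_threshold_in[of 0] by (simp add: pure_threshold_def zero_enat_def)
  }
qed

text \<open>
  A ratio that decreases strictly to a nonnegative limit is positive everywhere; then all \<open>F(n,\<theta>)\<close> are
  positive, and a finite threshold is refuted by the level \<open>n\<^sub>0\<close> at which it does not join surely.
\<close>

lemma equilibria_if_always_worthwhile:
  assumes "0 \<le> lim (H_U M)"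
  shows "{s \<in> threshold_strategies. equilibrium M s} = {pure_threshold \<infinity>}"
proof (intro equalityI subsetI)
  have weight: "0 \<le> weight1"
    using assms tot_D_pos by (simp add: lim_H_U zero_le_divide_iff)
  note pos = thinned_benefit_pos_if_weight1_nonneg[OF weight]
  fix s
  {
    assume "s \<in> {s \<in> threshold_strategies. equilibrium M s}"
    then have s: "s \<in> threshold_strategies" and eq: "equilibrium M s" by auto
    from s show "s \<in> {pure_threshold \<infinity>}"
    proof (cases rule: threshold_strategies_cases)
      case (1 n)
      then show ?thesis using eq pos[of 1 n] by (simp add: equilibrium_pure_threshold_iff)
    next
      case (2 n \<theta>)
      then show ?thesis using eq pos[of "1 - \<theta>" n] by (simp add: equilibrium_mixed_threshold_iff)
    next
      case 3
      then show ?thesis by (simp add: pure_threshold_def)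
    qed
  next
    assume "s \<in> {pure_threshold \<infinity>}"
    moreover have "equilibrium M (\<lambda>_. 1)"
      using pos[of 0] by (simp add: equilibrium_always_join_iff less_imp_le)
    ultimately show "s \<in> {s \<in> threshold_strategies. equilibrium M s}"
      using pure_threshold_in[of \<infinity>] by (simp add: pure_threshold_def)
  }
qed

text \<open>
  The threshold \<open>n_U\<close> itself is an equilibrium: \<open>F(n,1) \<ge> 0\<close> below it, and from \<open>n_U\<close> on all terms of the tail
  sum \<open>F(n_U,0)\<close> are negative. A negative limit makes \<open>n_U\<close> finite, so the interval contains no \<open>\<infinity>\<close>.
\<close>

lemma pure_equilibria_if_eventually_worthless:
  assumes "lim (H_U M) < 0"
  shows "{s \<in> pure_threshold_strategies. equilibrium M s} = pure_threshold ` {n_L M..n_U M}"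
    and "\<exists>s\<in>pure_threshold_strategies. equilibrium M s"
proof -
  obtain N where N: "benefit N < 0" using eventually_benefit_neg[OF assms] by blast
  have "\<not> enat (Suc N) \<le> n_U M"
    using N unfolding le_n_U_iff by (meson lessI not_le)
  then have finite: "n_U M \<noteq> \<infinity>"
    by (cases "n_U M") simp_all
  have iff: "equilibrium M (pure_threshold m) \<longleftrightarrow> m \<in> {n_L M..n_U M}" for m
  proof (cases m)
    case (enat n)
    then show ?thesis by (simp add: pure_threshold_def equilibrium_pure_iff_range)
  next
    case infinity
    have "\<not> equilibrium M (\<lambda>_. 1)"
      using N unfolding equilibrium_always_join_iff not_all not_le by blast
    then show ?thesis using infinity finite by (simp add: pure_threshold_def)
  qed
  have "{s \<in> pure_threshold_strategies. equilibrium M s} = pure_threshold ` {m. equilibrium M (pure_threshold m)}"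
    unfolding pure_threshold_strategies_def by blast
  then show "{s \<in> pure_threshold_strategies. equilibrium M s} = pure_threshold ` {n_L M..n_U M}"
    by (simp only: iff Collect_mem_eq)
  obtain n where n: "n_U M = enat n" using finite by (cases "n_U M") simp_all
  have "benefit n < 0"
  proof -
    have "\<not> enat (Suc n) \<le> n_U M" by (simp add: n)
    then obtain k where k: "k < Suc n" "benefit k < 0"
      unfolding le_n_U_iff by (meson not_le)
    show ?thesis
    proof (cases "k = n")
      case False
      then show ?thesis using benefit_single_crossing[of k n] k by simp
    qed (use k in simp)
  qed
  then have "n_L M \<le> enat n"
    using thinned_benefit_neg_if_benefit_nonpos[of n 1] by (simp add: n_L_le_iff)
  then have "equilibrium M (pure_threshold (enat n))" by (simp add: iff n)
  then show "\<exists>s\<in>pure_threshold_strategies. equilibrium M s"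
    unfolding pure_threshold_strategies_def by blast
qed

lemma mixed_equilibria:
  "{s \<in> mixed_threshold_strategies. equilibrium M s}
     = (\<lambda>n. threshold n (theta_eq M n)) ` mixed_range M"
proof (intro equalityI subsetI)
  fix s
  assume "s \<in> {s \<in> mixed_threshold_strategies. equilibrium M s}"
  then obtain n \<theta> where s: "s = threshold n \<theta>" and \<theta>: "0 < \<theta>" "\<theta> < 1" and "equilibrium M s"
    by (auto simp: mixed_threshold_strategies_def)
  then have root: "n \<in> mixed_range M" "F M n \<theta> = 0"
    by (simp_all add: equilibrium_mixed_iff_root)
  then have "\<theta> = theta_eq M n"
    using mixed_root_unique[OF root(1)] theta_eq_root[OF root(1)] \<theta> by blast
  then show "s \<in> (\<lambda>n. threshold n (theta_eq M n)) ` mixed_range M"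
    using s root by blast
next
  fix s
  assume "s \<in> (\<lambda>n. threshold n (theta_eq M n)) ` mixed_range M"
  then obtain n where n: "n \<in> mixed_range M" "s = threshold n (theta_eq M n)" by blast
  then show "s \<in> {s \<in> mixed_threshold_strategies. equilibrium M s}"
    using theta_eq_root[OF n(1)] equilibrium_mixed_iff_root[of "theta_eq M n" n]
    by (auto simp: mixed_threshold_strategies_def)
qed

end

theorem theorem5p1:
  fixes M :: clearing_model
  assumes "valid_model M"
    and "(vis M E1 - vis M E2) * (rho M E1 - rho M E2) < 0"
  shows "(\<exists>s\<in>threshold_strategies. equilibrium M s) \<and>
    (H_U M 0 < 0 \<longrightarrow>
       {s \<in> threshold_strategies. equilibrium M s} = {pure_threshold 0}) \<and>
    (H_U M 0 \<ge> 0 \<and> lim (H_U M) < 0 \<longrightarrow>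
       (\<exists>s\<in>pure_threshold_strategies. equilibrium M s) \<and>
       {s \<in> pure_threshold_strategies. equilibrium M s} = pure_threshold ` {n_L M..n_U M} \<and>
       (\<forall>n\<^sub>0\<in>mixed_range M. \<exists>!\<theta>. 0 < \<theta> \<and> \<theta> < 1 \<and> F M n\<^sub>0 \<theta> = 0) \<and>
       {s \<in> mixed_threshold_strategies. equilibrium M s} =
         (\<lambda>n\<^sub>0. threshold n\<^sub>0 (theta_eq M n\<^sub>0)) ` mixed_range M) \<and>
    (lim (H_U M) \<ge> 0 \<longrightarrow>
       {s \<in> threshold_strategies. equilibrium M s} = {pure_threshold \<infinity>})"
proof -
  interpret avoid_the_crowd M
    using assms by unfold_locales
  have "\<exists>s\<in>threshold_strategies. equilibrium M s"
  proof (cases "lim (H_U M) < 0")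
    case True
    then obtain m where "equilibrium M (pure_threshold m)"
      using pure_equilibria_if_eventually_worthless(2) by (auto simp: pure_threshold_strategies_def)
    then show ?thesis using pure_threshold_in by blast
  next
    case False
    then have "pure_threshold \<infinity> \<in> {s \<in> threshold_strategies. equilibrium M s}"
      by (subst equilibria_if_always_worthwhile) simp_all
    then show ?thesis by blast
  qed
  then show ?thesis
    by (intro conjI impI ballI equilibria_if_never_worthwhile equilibria_if_always_worthwhile
        pure_equilibria_if_eventually_worthless mixed_root_unique mixed_equilibria) auto
qed

end
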